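(* Let $E\subset\mathbb{R}$ with $D^*(E)>0$. Then there exist an ergodic measure preserving flow $(X,\mathcal{X},\mu,\{T_t\}_{t\in\mathbb{R}})$ and a set $\widetilde{E}\in\mathcal{X}$ with $\mu(\widetilde{E})\ge D^*(E)$ such that for every finite set $\{u_1,u_2,\ldots,u_k\}\subseteq\mathbb{R}$ and every $\delta>0$, $$D^*\bigl(E_\delta\cap(E_\delta-u_1)\cap\cdots\cap(E_\delta-u_k)\bigr)\ge\mu\bigl(\widetilde{E}\cap T_{u_1}^{-1}\widetilde{E}\cap\cdots\cap T_{u_k}^{-1}\widetilde{E}\bigr).$$
   Context: $m$ is Lebesgue measure on $\mathbb{R}$. The upper Banach density of a (Lebesgue measurable) set $E\subseteq\mathbb{R}$ is $D^*(E)=\limsup_{(N-M)\to\infty}\frac{m(E\cap[M,N])}{N-M}$. For $\delta>0$, $E_\delta=\{v\in\mathbb{R}\colon |v-e|<\delta\text{ for some }e\in E\}$. A measure preserving flow $(X,\mathcal{X},\mu,\{T_t\})$ consists of a Lebesgue space with $\mu(X)=1$ and invertible measure preserving transformations $T_t$, $t\in\mathbb{R}$, such that $(t,x)\mapsto T_t(x)$ is measurable, $T_0$ is the identity, and $T_s\circ T_t=T_{s+t}$. It is ergodic if every $A\in\mathcal{X}$ with $T_t(A)=A$ for all $t\in\mathbb{R}$ has $\mu(A)\in\{0,1\}$. *)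

theory Defs
  imports "HOL-Probability.Probability"
begin

text \<open>The filter describes pairs \<open>(M, N)\<close> with \<open>N - M\<close> tending to infinity, the location of
  the interval \<open>[M, N]\<close> being arbitrary.\<close>

definition upper_Banach_density :: "real set \<Rightarrow> ereal" where
  "upper_Banach_density E =
     Limsup (filtercomap (\<lambda>(M, N). N - M) at_top)
       (\<lambda>(M, N). ereal (measure lebesgue (E \<inter> {M..N}) / (N - M)))"

definition fatten :: "real \<Rightarrow> real set \<Rightarrow> real set" where
  "fatten \<delta> E = {v. \<exists>e\<in>E. \<bar>v - e\<bar> < \<delta>}"

definition translate_minus :: "real set \<Rightarrow> real \<Rightarrow> real set" where
  "translate_minus E u = (\<lambda>v. v - u) ` E"

definition iso_mod0 :: "'a measure \<Rightarrow> 'b measure \<Rightarrow> bool" where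
  "iso_mod0 M N \<longleftrightarrow>
     (\<exists>A B \<phi>. A \<in> sets M \<and> B \<in> sets N \<and>
        space M - A \<in> null_sets M \<and> space N - B \<in> null_sets N \<and>
        bij_betw \<phi> A B \<and>
        \<phi> \<in> restrict_space M A \<rightarrow>\<^sub>M restrict_space N B \<and>
        inv_into A \<phi> \<in> restrict_space N B \<rightarrow>\<^sub>M restrict_space M A \<and>
        (\<forall>C\<in>sets N. C \<subseteq> B \<longrightarrow> emeasure M (\<phi> -` C \<inter> A) = emeasure N C))"

text \<open>A Lebesgue space (in the sense of Rokhlin) of total mass one: a complete probability space
  that is isomorphic modulo null sets to the disjoint union of an interval \<open>[0, s]\<close> carrying
  Lebesgue measure and countably many atoms. The set \<open>P\<close> collects the atoms; it may be empty, and
  \<open>s = 0\<close> is the purely atomic case.\<close>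

definition Lebesgue_prob_space :: "'a measure \<Rightarrow> bool" where
  "Lebesgue_prob_space M \<longleftrightarrow>
     prob_space M \<and> complete_measure M \<and>
     (\<exists>P (s::real). countable P \<and> P \<subseteq> space M \<and> (\<forall>p\<in>P. {p} \<in> sets M \<and> emeasure M {p} > 0) \<and>
        0 \<le> s \<and> iso_mod0 (restrict_space M (space M - P)) (lebesgue_on {0..s}))"

definition invertible_measure_preserving :: "'a measure \<Rightarrow> ('a \<Rightarrow> 'a) \<Rightarrow> bool" where
  "invertible_measure_preserving M f \<longleftrightarrow>
     bij_betw f (space M) (space M) \<and>
     f \<in> M \<rightarrow>\<^sub>M M \<and> inv_into (space M) f \<in> M \<rightarrow>\<^sub>M M \<and>
     (\<forall>A\<in>sets M. emeasure M (f -` A \<inter> space M) = emeasure M A)"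

text \<open>Since the sigma-algebra of a Lebesgue space is complete, joint measurability of
  \<open>(t, x) \<mapsto> T t x\<close> refers to the completed product of \<open>\<real>\<close> and \<open>M\<close>; the product of the Borel
  sets with \<open>M\<close> would already exclude, for instance, the rotation flow on the circle with its
  Lebesgue measurable sets.\<close>

definition measure_preserving_flow :: "'a measure \<Rightarrow> (real \<Rightarrow> 'a \<Rightarrow> 'a) \<Rightarrow> bool" where
  "measure_preserving_flow M T \<longleftrightarrow>
     Lebesgue_prob_space M \<and>
     (\<forall>t. invertible_measure_preserving M (T t)) \<and>
     (\<lambda>(t, x). T t x) \<in> completion (lborel \<Otimes>\<^sub>M M) \<rightarrow>\<^sub>M M \<and>
     (\<forall>x\<in>space M. T 0 x = x) \<and>
     (\<forall>s t. \<forall>x\<in>space M. T s (T t x) = T (s + t) x)"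

definition ergodic_flow :: "'a measure \<Rightarrow> (real \<Rightarrow> 'a \<Rightarrow> 'a) \<Rightarrow> bool" where
  "ergodic_flow M T \<longleftrightarrow>
     measure_preserving_flow M T \<and>
     (\<forall>A\<in>sets M. (\<forall>t. T t ` A = A) \<longrightarrow> measure M A = 0 \<or> measure M A = 1)"

end

theory Submission
  imports Defs
begin

text \<open>Furstenberg's correspondence, on the space of \<open>1\<close>-Lipschitz functions \<open>\<real> \<rightarrow> [0, 1]\<close> with the
  translation flow. The set \<open>E\<close> is represented by \<open>f t = max 0 (1 - infdist t E)\<close> and \<open>E'\<close> is the closed
  set of all \<open>x\<close> with \<open>x 0 = 1\<close>. Empirical measures of the orbit of \<open>f\<close> along intervals realising the
  density have a weak limit which is invariant, lives on the orbit closure of \<open>f\<close> and gives \<open>E'\<close> at least the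
  density of \<open>E\<close>. Among these measures, one maximising first the mass of \<open>E'\<close> and then a strictly convex
  functional is extreme, hence ergodic. For any invariant measure on the orbit closure, the integral of a
  continuous \<open>h\<close> is at most the supremum of the averages of \<open>h\<close> over orbit segments of \<open>f\<close> of any given length;
  taking for \<open>h\<close> a continuous function between the indicators of \<open>E' \<inter> \<Inter>u\<in>U. T u -` E'\<close> and of
  \<open>{x. \<forall>u\<in>U \<union> {0}. x u > 1 - \<delta>}\<close> gives the inequality. Compactness and the structure of a Lebesgue space are
  both transferred from the real line through a Borel coding whose inverse is Schoenberg's space-filling curve.\<close>

section \<open>Coding Lipschitz functions by real numbers\<close>

text \<open>The indicator of \<open>E\<close> cannot serve as a point of the system: its translates
  do not depend continuously on time, and weak limits lose sight of a merely measurable set.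
  Smoothing it to a 1-Lipschitz function buys a compact space with a continuous action of the line;
  the price is the fattening by \<delta>. Semicontinuity then pulls in two directions. In a weak
  limit the mass of a closed set can only jump up, which is what the bound \<mu>(E') \<ge> D*(E)
  needs. The recurrence inequality bounds the mass of an intersection from above by a density, which
  needs room around that closed set, and \<delta> supplies this room. The ergodic measure found by
  maximising need not be a limit of the chosen empirical measures, and its typical points need not
  lie on the orbit of \<open>f\<close>. Hence the last inequality is proved for every invariant
  measure on the orbit closure. Maximising yields extremality and the full value D*(E), without an
  epsilon of loss, because the maxima are attained.\<close>

definition lip :: "(real \<Rightarrow> real) set" where
  "lip = {x. (\<forall>t. 0 \<le> x t \<and> x t \<le> 1) \<and> (\<forall>s t. \<bar>x s - x t\<bar> \<le> \<bar>s - t\<bar>)}"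

text \<open>\<open>lip\<close> is not a measurable subset of the uncountable product, so this is a
  trace sigma-algebra. It is countably generated all the same, see
  \<open>sets_lipM_cyl\<close>.\<close>

definition lipM :: "(real \<Rightarrow> real) measure" where
  "lipM = restrict_space (Pi\<^sub>M UNIV (\<lambda>_. borel)) lip"

lemma space_lipM [simp]: "space lipM = lip"
  by (simp add: lipM_def space_restrict_space space_PiM PiE_def extensional_def)

lemma lipD: assumes "x \<in> lip" shows "0 \<le> x t" "x t \<le> 1" "\<bar>x s - x t\<bar> \<le> \<bar>s - t\<bar>"
  using assms by (auto simp: lip_def)

lemma measurable_eval_lipM [measurable]: "(\<lambda>x. x t) \<in> borel_measurable lipM"
  unfolding lipM_def by (intro measurable_restrict_space1 measurable_component_singleton) simp

lemma measurable_lipM: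
  assumes "\<And>t. (\<lambda>\<omega>. f \<omega> t) \<in> borel_measurable M" and "\<And>\<omega>. \<omega> \<in> space M \<Longrightarrow> f \<omega> \<in> lip"
  shows "f \<in> M \<rightarrow>\<^sub>M lipM"
  unfolding lipM_def
  by (intro measurable_restrict_space2 measurable_PiM_single') (use assms in auto)

lemma lip_continuous: "x \<in> lip \<Longrightarrow> isCont x t"
proof -
  assume x: "x \<in> lip"
  have "((\<lambda>s. x s - x t) \<longlongrightarrow> 0) (at t)"
    by (rule Lim_null_comparison[where g="\<lambda>s. \<bar>s - t\<bar>"])
       (use lipD(3)[OF x] in \<open>auto intro!: always_eventually tendsto_eq_intros\<close>)
  then show ?thesis by (simp add: isCont_def LIM_zero_iff)
qed

text \<open>All functions share the Lipschitz constant 1, so moving from \<open>t\<close> to a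
  rational within e/3 costs at most e/3 for \<open>x n\<close> and for \<open>y\<close>, uniformly
  in \<open>n\<close>.\<close>

lemma lip_tendsto_rat:
  assumes x: "\<And>n. x n \<in> lip" and y: "y \<in> lip"
    and lim: "\<And>q::rat. (\<lambda>n. x n (of_rat q)) \<longlonglongrightarrow> y (of_rat q)"
  shows "(\<lambda>n. x n t) \<longlonglongrightarrow> y t"
proof (rule metric_LIMSEQ_I)
  fix e :: real assume e: "e > 0"
  obtain q where q: "t < real_of_rat q" "real_of_rat q < t + e/3"
    using of_rat_dense[of t "t + e/3"] e by auto
  obtain N where N: "\<And>n. n \<ge> N \<Longrightarrow> \<bar>x n (of_rat q) - y (of_rat q)\<bar> < e/3"
    using metric_LIMSEQ_D[OF lim, of "e/3" q] e by (auto simp: dist_real_def)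
  have "dist (x n t) (y t) < e" if "n \<ge> N" for n
    using N[OF that] lipD(3)[OF x, of n t "of_rat q"] lipD(3)[OF y, of t "of_rat q"] q
    unfolding dist_real_def by linarith
  then show "\<exists>N. \<forall>n\<ge>N. dist (x n t) (y t) < e" by blast
qed

text \<open>Schoenberg's generating function, with a truncated cosine in place of the usual
  piecewise linear one. What matters is continuity, period 2 and the plateaus 0 on [0, 1/3] and 1 on
  [2/3, 1].\<close>

definition wave :: "real \<Rightarrow> real" where
  "wave t = max 0 (min 1 (1/2 - cos (pi * t)))"

lemma wave_bounds: "0 \<le> wave t" "wave t \<le> 1"
  by (auto simp: wave_def)

lemma isCont_wave: "isCont wave t"
  unfolding wave_def by (intro continuous_intros)

lemma wave_measurable [measurable]: "wave \<in> borel_measurable borel"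
  by (intro borel_measurable_continuous_onI continuous_at_imp_continuous_on ballI isCont_wave)

lemma wave_periodic: "wave (2 * of_int k + t) = wave t"
proof -
  have "pi * (2 * of_int k + t) = pi * t + 2 * pi * of_int k" by (simp add: algebra_simps)
  then show ?thesis unfolding wave_def by (simp add: cos_add)
qed

lemma wave_0: assumes "0 \<le> t" "t \<le> 1/3" shows "wave t = 0"
proof -
  have "cos (pi/3) \<le> cos (pi * t)"
    using assms by (intro cos_monotone_0_pi_le) (auto simp: field_simps)
  then show ?thesis by (simp add: wave_def cos_60)
qed

lemma wave_1: assumes "2/3 \<le> t" "t \<le> 1" shows "wave t = 1"
proof -
  have "cos (pi * t) \<le> cos (pi * (2/3))"
    using assms by (intro cos_monotone_0_pi_le) (auto simp: field_simps)
  also have "\<dots> = - (1/2)" using cos_120 by (simp add: mult.commute field_simps)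
  finally show ?thesis by (simp add: wave_def)
qed

text \<open>This identity makes Schoenberg's space-filling curve surjective.\<close>

lemma wave_ternary:
  fixes b :: "nat \<Rightarrow> real"
  assumes b: "\<And>n. b n = 0 \<or> b n = 1"
  shows "wave (3 ^ n * (\<Sum>i. 2 * b i / 3 ^ Suc i)) = b n"
proof -
  define S where "S n = (\<Sum>i. 2 * b (i + n) / 3 ^ Suc i)" for n
  have b01: "0 \<le> b n" "b n \<le> 1" for n using b[of n] by auto
  have geo: "(\<lambda>i. 2 / 3 ^ Suc i) sums (1::real)"
    using sums_mult[OF geometric_sums[of "1/3::real"], of "2/3"] by (simp add: power_divide)
  have summ: "summable (\<lambda>i. 2 * b (i + n) / 3 ^ Suc i)" for n
    by (rule summable_comparison_test'[OF sums_summable[OF geo], of 0])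
       (use b01 in \<open>auto simp: field_simps\<close>)
  have S0: "0 \<le> S n" for n unfolding S_def by (intro suminf_nonneg summ) (use b01 in auto)
  have S1: "S n \<le> 1" for n unfolding S_def using geo b01
    by (subst sums_unique[OF geo]) (intro suminf_le summ sums_summable[OF geo], auto simp: field_simps)
  have step: "S n = (2 * b n + S (Suc n)) / 3" for n
  proof -
    have "S n = (\<Sum>i. 2 * b (Suc i + n) / 3 ^ Suc (Suc i)) + 2 * b n / 3"
      unfolding S_def by (subst suminf_split_head[OF summ]) simp
    also have "(\<Sum>i. 2 * b (Suc i + n) / 3 ^ Suc (Suc i)) = (\<Sum>i. (1/3) * (2 * b (i + Suc n) / 3 ^ Suc i))"
      by (intro suminf_cong) simp
    also have "\<dots> = (1/3) * S (Suc n)" unfolding S_def by (rule suminf_mult[OF summ])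
    finally show ?thesis by (simp add: field_simps)
  qed
  \<comment> \<open>Multiplication by 3^n moves \<open>n\<close> ternary digits in front of the
    point. All digits are 0 or 2, so the integer part is even and is absorbed by the period of
    \<open>wave\<close>.\<close>
  have "\<exists>k::int. 3 ^ n * S 0 = 2 * of_int k + S n" for n
  proof (induction n)
    case 0 show ?case by (auto intro: exI[of _ 0])
  next
    case (Suc n)
    then obtain k where k: "3 ^ n * S 0 = 2 * of_int k + S n" by blast
    obtain c :: int where c: "b n = of_int c" using b[of n] by (metis of_int_0 of_int_1)
    have "3 ^ Suc n * S 0 = 3 * (2 * of_int k + S n)" using k by simp
    also have "\<dots> = 2 * of_int (3 * k + c) + S (Suc n)" using step[of n] c by simp
    finally show ?case by blast
  qed
  then obtain k :: int where "3 ^ n * S 0 = 2 * of_int k + S n" by blast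
  then have "wave (3 ^ n * S 0) = wave (S n)" by (simp add: wave_periodic)
  \<comment> \<open>By \<open>step\<close>, \<open>S n\<close> lies in [0, 1/3] or in [2/3, 1]
    according to \<open>b n\<close>, hence on a plateau.\<close>
  also have "\<dots> = b n"
    using b[of n] S0[of "Suc n"] S1[of "Suc n"] step[of n] wave_0[of "S n"] wave_1[of "S n"] by auto
  finally show ?thesis by (simp add: S_def)
qed

section \<open>Binary digits, the code and its inverse\<close>

definition digit :: "real \<Rightarrow> nat \<Rightarrow> real" where
  "digit x j = of_int (\<lfloor>2 ^ j * x\<rfloor> mod 2)"

lemma digit_01: "digit x j = 0 \<or> digit x j = 1"
  unfolding digit_def by (metis mod2_eq_if of_int_0 of_int_1)

lemma digit_measurable [measurable]: "(\<lambda>x. digit x j) \<in> borel_measurable borel"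
  unfolding digit_def
  by (rule measurable_compose[where g="\<lambda>i. real_of_int (i mod 2)" and N="count_space UNIV"]) 
     (auto intro: measurable_compose[OF _ measurable_real_floor])

lemma digit_sums:
  assumes "0 \<le> x" "x \<le> 1"
  shows "(\<lambda>j. digit x j / 2 ^ j) sums x"
proof -
  have part: "(\<Sum>j<Suc n. digit x j / 2 ^ j) = of_int \<lfloor>2 ^ n * x\<rfloor> / 2 ^ n" for n
  proof (induction n)
    case 0
    have "\<lfloor>x\<rfloor> = 0 \<or> \<lfloor>x\<rfloor> = 1" using assms by linarith
    then show ?case by (auto simp: digit_def)
  next
    case (Suc n)
    have "\<lfloor>2 ^ Suc n * x\<rfloor> div 2 = \<lfloor>(2 ^ Suc n * x) / of_int 2\<rfloor>"
      by (rule floor_divide_real_eq_div[symmetric]) simp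
    then have "\<lfloor>2 ^ Suc n * x\<rfloor> = 2 * \<lfloor>2 ^ n * x\<rfloor> + \<lfloor>2 ^ Suc n * x\<rfloor> mod 2"
      using mult_div_mod_eq[of 2 "\<lfloor>2 ^ Suc n * x\<rfloor>"] by simp
    then have "real_of_int \<lfloor>2 ^ Suc n * x\<rfloor> = 2 * of_int \<lfloor>2 ^ n * x\<rfloor> + digit x (Suc n)"
      unfolding digit_def by (metis of_int_add of_int_mult of_int_numeral)
    then show ?case using Suc.IH by (simp add: field_simps)
  qed
  have "(\<lambda>n. of_int \<lfloor>2 ^ n * x\<rfloor> / 2 ^ n) \<longlonglongrightarrow> x"
  proof (rule LIM_zero_cancel, rule Lim_null_comparison[where g="\<lambda>n. (1/2) ^ n"])
    have "norm (of_int \<lfloor>2 ^ n * x\<rfloor> / 2 ^ n - x) \<le> (1/2) ^ n" for n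
    proof -
      have "of_int \<lfloor>2 ^ n * x\<rfloor> / 2 ^ n - x = (of_int \<lfloor>2 ^ n * x\<rfloor> - 2 ^ n * x) * (1/2) ^ n"
        by (simp add: field_simps power_divide)
      moreover have "\<bar>of_int \<lfloor>2 ^ n * x\<rfloor> - 2 ^ n * x\<bar> \<le> 1" by linarith
      ultimately show ?thesis by (simp add: abs_mult mult_left_le_one_le)
    qed
    then show "\<forall>\<^sub>F n in sequentially. norm (of_int \<lfloor>2 ^ n * x\<rfloor> / 2 ^ n - x) \<le> (1/2) ^ n" by simp
    show "(\<lambda>n. (1/2::real) ^ n) \<longlonglongrightarrow> 0" by (simp add: LIMSEQ_power_zero)
  qed
  then have "(\<lambda>n. \<Sum>j<Suc n. digit x j / 2 ^ j) \<longlonglongrightarrow> x" unfolding part .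
  then show ?thesis unfolding sums_def by (rule LIMSEQ_imp_Suc)
qed

text \<open>The binary digits of the values \<open>x q\<close>, \<open>q\<close> rational, become the ternary digits of
  \<open>code x\<close>; the coordinates \<open>curve q\<close> of Schoenberg's curve recover these values, and their
  McShane extension \<open>decode\<close> recovers \<open>x\<close>. The sums in \<open>digit_sums\<close> start at \<open>2^0\<close> since the
  value \<open>1\<close> has to be encoded too.\<close>

definition code :: "(real \<Rightarrow> real) \<Rightarrow> real" where
  "code x = (\<Sum>n. 2 * (case from_nat n of (q :: rat, j) \<Rightarrow> digit (x (of_rat q)) j) / 3 ^ Suc n)"

definition curve :: "rat \<Rightarrow> real \<Rightarrow> real" where
  "curve q y = (\<Sum>j. wave (3 ^ to_nat (q, j) * y) / 2 ^ j)"

definition decode :: "real \<Rightarrow> real \<Rightarrow> real" where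
  "decode y t = (INF q. min 1 (curve q y) + \<bar>t - of_rat q\<bar>)"

lemma code_measurable [measurable]: "code \<in> borel_measurable lipM"
  unfolding code_def by (auto split: prod.split)

lemma code_bounds: "0 \<le> code x" "code x \<le> 1"
proof -
  have geo: "(\<lambda>i. 2 / 3 ^ Suc i) sums (1::real)"
    using sums_mult[OF geometric_sums[of "1/3::real"], of "2/3"] by (simp add: power_divide)
  have d: "0 \<le> (case from_nat n of (q :: rat, j) \<Rightarrow> digit (x (of_rat q)) j)"
    "(case from_nat n of (q :: rat, j) \<Rightarrow> digit (x (of_rat q)) j) \<le> 1" for n
    using digit_01 by (auto split: prod.split) (metis order.refl zero_le_one)+
  have summ: "summable (\<lambda>n. 2 * (case from_nat n of (q :: rat, j) \<Rightarrow> digit (x (of_rat q)) j) / 3 ^ Suc n)"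
    by (rule summable_comparison_test'[OF sums_summable[OF geo], of 0])
       (use d in \<open>auto simp: field_simps\<close>)
  show "0 \<le> code x" unfolding code_def by (intro suminf_nonneg summ) (use d in auto)
  show "code x \<le> 1" unfolding code_def
    by (subst sums_unique[OF geo]) (intro suminf_le summ sums_summable[OF geo], use d in \<open>auto simp: field_simps\<close>)
qed

lemma curve_summable: "summable (\<lambda>j. wave (3 ^ to_nat (q, j) * y) / 2 ^ j)"
  by (rule summable_comparison_test'[OF summable_geometric[of "1/2::real"], of 0])
     (use wave_bounds in \<open>auto simp: power_divide divide_right_mono\<close>)

lemma curve_nonneg: "0 \<le> curve q y"
  unfolding curve_def by (intro suminf_nonneg curve_summable) (simp add: wave_bounds)

lemma curve_measurable [measurable]: "curve q \<in> borel_measurable borel"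
  unfolding curve_def by measurable

lemma curve_tendsto:
  assumes "y \<longlonglongrightarrow> z"
  shows "(\<lambda>n. curve q (y n)) \<longlonglongrightarrow> curve q z"
  unfolding curve_def
proof (rule tannerys_theorem[where M="\<lambda>j. (1/2) ^ j", THEN conjunct2, THEN conjunct2])
  show "((\<lambda>n. wave (3 ^ to_nat (q, j) * y n) / 2 ^ j) \<longlongrightarrow> wave (3 ^ to_nat (q, j) * z) / 2 ^ j) sequentially" for j
    by (intro tendsto_intros isCont_tendsto_compose[OF isCont_wave] assms) auto
  show "\<forall>\<^sub>F (j, n) in at_top \<times>\<^sub>F sequentially. norm (wave (3 ^ to_nat (q, j) * y n) / 2 ^ j) \<le> (1/2) ^ j"
    using wave_bounds by (auto intro!: always_eventually simp: power_divide divide_right_mono)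
qed auto

text \<open>The ternary digit of \<open>code x\<close> at position \<open>to_nat (q, j)\<close> is
  twice the \<open>j\<close>-th binary digit of \<open>x q\<close>; \<open>wave_ternary\<close>
  reads it off and \<open>digit_sums\<close> reassembles the value.\<close>

lemma curve_code: assumes "x \<in> lip" shows "curve q (code x) = x (of_rat q)"
proof -
  have "wave (3 ^ to_nat (q, j) * code x) = digit (x (of_rat q)) j" for j
    unfolding code_def
    by (subst wave_ternary) (auto split: prod.split simp: digit_01)
  then show ?thesis unfolding curve_def
    using digit_sums[OF lipD(1,2)[OF assms]] by (simp add: sums_iff)
qed

lemma decode_bdd: "bdd_below (range (\<lambda>q. min 1 (curve q y) + \<bar>t - of_rat q\<bar>))"
  using curve_nonneg by (intro bdd_belowI[of _ 0]) auto

text \<open>This holds for every real \<open>y\<close>, code or not: an infimum of 1-Lipschitz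
  functions of \<open>t\<close> is 1-Lipschitz. The cut-off \<open>min 1\<close> is there because
  \<open>curve\<close> may reach 2; rationals close to \<open>t\<close> then give the upper bound
  1.\<close>

lemma decode_lip: "decode y \<in> lip"
proof -
  have up: "decode y t \<le> min 1 (curve q y) + \<bar>t - of_rat q\<bar>" for t q
    unfolding decode_def by (rule cINF_lower[OF decode_bdd]) simp
  have "0 \<le> decode y t" for t
    unfolding decode_def by (rule cINF_greatest) (use curve_nonneg in auto)
  moreover have "decode y t \<le> 1" for t
  proof (rule field_le_epsilon)
    fix e :: real assume "e > 0"
    then obtain q where "t < real_of_rat q" "real_of_rat q < t + e"
      using of_rat_dense[of t "t + e"] by auto
    then show "decode y t \<le> 1 + e" using up[of t q] by linarith
  qed
  moreover have "decode y s - \<bar>s - t\<bar> \<le> decode y t" for s t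
    unfolding decode_def[of y t]
  proof (rule cINF_greatest)
    fix q show "decode y s - \<bar>s - t\<bar> \<le> min 1 (curve q y) + \<bar>t - of_rat q\<bar>"
      using up[of s q] by linarith
  qed simp
  ultimately show ?thesis by (auto simp: lip_def abs_le_iff) (smt (verit))+
qed

lemma decode_measurable [measurable]: "decode \<in> borel \<rightarrow>\<^sub>M lipM"
  by (rule measurable_lipM) (auto simp: decode_lip decode_def)

text \<open>The McShane infimum is attained at \<open>q\<close> itself once the data on the
  rationals are 1-Lipschitz. Both assumptions are closed conditions, so they survive limits of
  codes.\<close>

lemma decode_curve:
  assumes "\<And>q. curve q y \<le> 1" "\<And>q r. \<bar>curve q y - curve r y\<bar> \<le> \<bar>of_rat q - of_rat r\<bar>"
  shows "decode y (of_rat q) = curve q y"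
proof (rule antisym)
  show "decode y (of_rat q) \<le> curve q y"
    unfolding decode_def by (rule cINF_lower2[OF decode_bdd, of q]) auto
  show "curve q y \<le> decode y (of_rat q)" unfolding decode_def
    by (rule cINF_greatest) (use assms in \<open>auto simp: min_def abs_le_iff\<close>, (smt (verit))+)
qed

lemma lip_eq_rat:
  assumes "x \<in> lip" "y \<in> lip" "\<And>q. x (of_rat q) = y (of_rat q)" shows "x = y"
proof
  fix t
  show "x t = y t" using LIMSEQ_unique[OF lip_tendsto_rat[of "\<lambda>_. x" y t] tendsto_const] assms by auto
qed

lemma decode_code: assumes "x \<in> lip" shows "decode (code x) = x"
  by (rule lip_eq_rat[OF decode_lip assms], subst decode_curve)
     (use assms lipD[OF assms] in \<open>auto simp: curve_code\<close>)

text \<open>A fixed-point description: the image becomes the set where two measurable functions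
  agree, and is therefore Borel.\<close>

lemma code_image: "code ` lip = {y. code (decode y) = y}"
proof safe
  fix y assume "code (decode y) = y"
  then show "y \<in> code ` lip" using decode_lip[of y] by (metis imageI)
qed (simp add: decode_code)

lemma code_range_borel: "code ` lip \<in> sets borel"
proof -
  have "(\<lambda>y. code (decode y)) \<in> borel_measurable borel"
    by measurable
  then show ?thesis unfolding code_image by measurable
qed

text \<open>The limit \<open>z\<close> need not be a code, since binary digits jump at dyadic
  values. The curve values pass to the limit, and with them the two conditions of
  \<open>decode_curve\<close>.\<close>

lemma decode_tendsto:
  assumes y: "\<And>n. y n \<in> code ` lip" and lim: "y \<longlonglongrightarrow> z"
  shows "(\<lambda>n. decode (y n) t) \<longlonglongrightarrow> decode z t"
proof (rule lip_tendsto_rat[OF decode_lip decode_lip])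
  fix q :: rat
  have cv: "(\<lambda>n. curve q (y n)) \<longlonglongrightarrow> curve q z" for q by (rule curve_tendsto[OF lim])
  have yc: "decode (y n) (of_rat q) = curve q (y n)" for n q
    using y[of n] by (auto simp: decode_code curve_code)
  have "decode z (of_rat q) = curve q z"
  proof (rule decode_curve)
    show "curve q z \<le> 1" for q
      by (rule LIMSEQ_le_const2[OF cv]) (use lipD(2)[OF decode_lip] yc in metis)
    show "\<bar>curve q z - curve r z\<bar> \<le> \<bar>of_rat q - of_rat r\<bar>" for q r
      by (rule LIMSEQ_le_const2[OF tendsto_rabs[OF tendsto_diff[OF cv cv]]])
         (use lipD(3)[OF decode_lip] yc in metis)
  qed
  then show "(\<lambda>n. decode (y n) (of_rat q)) \<longlonglongrightarrow> decode z (of_rat q)" using cv yc by simp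
qed

section \<open>Completed measures on coded spaces are Lebesgue spaces\<close>

lemma iso_mod0_completion:
  assumes X [measurable]: "X \<in> sets M" and Y [measurable]: "Y \<in> sets N"
    and A [measurable]: "A \<in> sets M" and AX: "A \<subseteq> X" and B [measurable]: "B \<in> sets N" and BY: "B \<subseteq> Y"
    and nullA: "X - A \<in> null_sets M" and nullB: "Y - B \<in> null_sets N"
    and bij: "bij_betw f A B"
    and pre: "\<And>C. C \<in> sets N \<Longrightarrow> f -` C \<inter> A \<in> sets M"
    and img: "\<And>C. C \<in> sets M \<Longrightarrow> C \<subseteq> A \<Longrightarrow> f ` C \<in> sets N"
    and em: "\<And>C. C \<in> sets N \<Longrightarrow> C \<subseteq> B \<Longrightarrow> emeasure M (f -` C \<inter> A) = emeasure N C"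
  shows "iso_mod0 (restrict_space (completion M) X) (restrict_space (completion N) Y)"
proof -
  have XM: "X \<subseteq> space M" and YN: "Y \<subseteq> space N"
    using sets.sets_into_space[OF X] sets.sets_into_space[OF Y] by auto
  have sX: "space (restrict_space (completion M) X) = X" and sY: "space (restrict_space (completion N) Y) = Y"
    using XM YN by (auto simp: space_restrict_space)
  have setsX: "C \<in> sets (restrict_space (completion M) X) \<longleftrightarrow> C \<subseteq> X \<and> C \<in> sets (completion M)" for C
    using X by (subst sets_restrict_space_iff) auto
  have setsY: "C \<in> sets (restrict_space (completion N) Y) \<longleftrightarrow> C \<subseteq> Y \<and> C \<in> sets (completion N)" for C
    using Y by (subst sets_restrict_space_iff) auto
  have rrX: "restrict_space (restrict_space (completion M) X) A = restrict_space (completion M) A"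
    using AX by (subst restrict_restrict_space) (auto simp: inf.absorb2)
  have rrY: "restrict_space (restrict_space (completion N) Y) B = restrict_space (completion N) B"
    using BY by (subst restrict_restrict_space) (auto simp: inf.absorb2)
  have spA: "space (restrict_space (completion M) A) = A" and spB: "space (restrict_space (completion N) B) = B"
    using AX BY XM YN by (auto simp: space_restrict_space)
  have inv: "inv_into A f -` C \<inter> B = f ` (C \<inter> A)" for C
    using bij by (auto simp: bij_betw_def inv_into_into f_inv_into_f intro!: image_eqI)
  have null_pre: "f -` C \<inter> A \<in> null_sets (completion M)" if C0: "C \<in> null_sets (completion N)" for C
  proof -
    obtain D where D: "D \<in> null_sets N" "C \<subseteq> D"
      using C0 unfolding null_sets_completion_iff2 by blast
    have DB: "D \<inter> B \<in> null_sets N" using D(1) B by (rule null_set_Int2)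
    then have "f -` (D \<inter> B) \<inter> A \<in> null_sets M"
      using pre[of "D \<inter> B"] em[of "D \<inter> B"] by (metis inf_le2 null_setsD1 null_setsD2 null_setsI)
    moreover have "f -` C \<inter> A \<subseteq> f -` (D \<inter> B) \<inter> A" using D bij by (auto simp: bij_betw_def)
    ultimately show ?thesis unfolding null_sets_completion_iff2 by blast
  qed
  have null_img: "f ` (C \<inter> A) \<in> null_sets (completion N)" if C0: "C \<in> null_sets (completion M)" for C
  proof -
    obtain D where D: "D \<in> null_sets M" "C \<subseteq> D"
      using C0 unfolding null_sets_completion_iff2 by blast
    have DA: "D \<inter> A \<in> null_sets M" using D(1) A by (rule null_set_Int2)
    then have 1: "f ` (D \<inter> A) \<in> sets N" by (intro img) auto
    have "f -` (f ` (D \<inter> A)) \<inter> A = D \<inter> A"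
      using bij by (auto simp: bij_betw_def dest: inj_onD)
    then have "emeasure N (f ` (D \<inter> A)) = 0"
      using em[OF 1] DA bij by (auto simp: bij_betw_def null_sets_def)
    then show ?thesis using 1 D by (auto simp: null_sets_completion_iff2 intro!: bexI[of _ "f ` (D \<inter> A)"])
  qed
  have f_meas: "f -` C \<inter> A \<in> sets (completion M)" if "C \<in> sets (completion N)" for C
  proof -
    have "f -` C \<inter> A = (f -` main_part N C \<inter> A) \<union> (f -` null_part N C \<inter> A)"
      using main_part_null_part_Un[OF that] by auto
    then show ?thesis
      using null_pre[OF null_part_null_sets[OF that]] pre[of "main_part N C"] that by auto
  qed
  have g_meas: "f ` (C \<inter> A) \<in> sets (completion N)" if "C \<in> sets (completion M)" for C
  proof -
    have "f ` (C \<inter> A) = f ` (main_part M C \<inter> A) \<union> f ` (null_part M C \<inter> A)"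
      using main_part_null_part_Un[OF that] by blast
    moreover have "f ` (main_part M C \<inter> A) \<in> sets N"
      using A that by (intro img) auto
    ultimately show ?thesis
      using null_img[OF null_part_null_sets[OF that]] by (auto intro: sets_completionI_sets)
  qed
  have em': "emeasure (completion M) (f -` C \<inter> A) = emeasure (completion N) C"
    if C: "C \<in> sets (completion N)" "C \<subseteq> B" for C
  proof -
    have mC: "main_part N C \<subseteq> B" "main_part N C \<in> sets N"
      using C main_part_null_part_Un[OF C(1)] by (blast, simp)
    have "f -` C \<inter> A = (f -` main_part N C \<inter> A) \<union> (f -` null_part N C \<inter> A)"
      using main_part_null_part_Un[OF C(1)] by auto
    then have "emeasure (completion M) (f -` C \<inter> A) = emeasure (completion M) (f -` main_part N C \<inter> A)"
      using null_pre[OF null_part_null_sets[OF C(1)]] pre[OF mC(2)]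
      by (simp add: emeasure_Un_null_set)
    also have "\<dots> = emeasure M (f -` main_part N C \<inter> A)"
      using pre[OF mC(2)] by (simp add: main_part_sets)
    also have "\<dots> = emeasure (completion N) C" using em[OF mC(2,1)] C by simp
    finally show ?thesis .
  qed
  show ?thesis
    unfolding iso_mod0_def sX sY
  proof (rule exI[of _ A], rule exI[of _ B], rule exI[of _ f], intro conjI ballI impI)
    show "A \<in> sets (restrict_space (completion M) X)" "B \<in> sets (restrict_space (completion N) Y)"
      using AX BY by (auto simp: setsX setsY)
    show "X - A \<in> null_sets (restrict_space (completion M) X)"
      using nullA by (subst null_sets_restrict_space) (auto intro: null_sets_completionI)
    show "Y - B \<in> null_sets (restrict_space (completion N) Y)"
      using nullB by (subst null_sets_restrict_space) (auto intro: null_sets_completionI)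
    show "f \<in> restrict_space (restrict_space (completion M) X) A \<rightarrow>\<^sub>M restrict_space (restrict_space (completion N) Y) B"
      unfolding rrX rrY
    proof (rule measurableI)
      fix C assume C: "C \<in> sets (restrict_space (completion N) B)"
      then have "C \<in> sets (completion N)" by (subst (asm) sets_restrict_space_iff) auto
      then have "f -` C \<inter> A \<in> sets (completion M)" by (rule f_meas)
      then show "f -` C \<inter> space (restrict_space (completion M) A) \<in> sets (restrict_space (completion M) A)"
        unfolding spA by (subst sets_restrict_space_iff) auto
    qed (use bij in \<open>auto simp: spA spB bij_betw_def\<close>)
    show "inv_into A f \<in> restrict_space (restrict_space (completion N) Y) B \<rightarrow>\<^sub>M restrict_space (restrict_space (completion M) X) A"
      unfolding rrX rrY
    proof (rule measurableI)
      fix C assume C: "C \<in> sets (restrict_space (completion M) A)"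
      then have "C \<in> sets (completion M)" by (subst (asm) sets_restrict_space_iff) auto
      then have "f ` (C \<inter> A) \<in> sets (completion N)" by (rule g_meas)
      moreover have "f ` (C \<inter> A) \<subseteq> B" using bij by (auto simp: bij_betw_def)
      ultimately show "inv_into A f -` C \<inter> space (restrict_space (completion N) B) \<in> sets (restrict_space (completion N) B)"
        unfolding spB inv by (subst sets_restrict_space_iff) auto
    qed (use bij in \<open>auto simp: spA spB bij_betw_def inv_into_into\<close>)
    fix C assume "C \<in> sets (restrict_space (completion N) Y)" "C \<subseteq> B"
    then show "emeasure (restrict_space (completion M) X) (f -` C \<inter> A) = emeasure (restrict_space (completion N) Y) C"
      using AX BY em'[of C] X Y by (subst (1 2) emeasure_restrict_space) (auto simp: setsY)
  qed (use bij in auto)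
qed

text \<open>The map \<open>c\<close> carries the atomless part to a law on the line with continuous
  distribution function \<open>F\<close>, and \<open>F\<close> straightens this law to Lebesgue
  measure; the quantile function is the inverse outside a null set. Borel images under
  \<open>c\<close> keep all sets involved measurable.\<close>

lemma Lebesgue_prob_space_completion:
  fixes c :: "'a \<Rightarrow> real"
  assumes "prob_space M" and c [measurable]: "c \<in> borel_measurable M" and inj: "inj_on c (space M)"
    and img: "\<And>A. A \<in> sets M \<Longrightarrow> c ` A \<in> sets borel"
  shows "Lebesgue_prob_space (completion M)"
proof -
  interpret prob_space M by fact
  define P where "P = {x \<in> space M. measure M {x} \<noteq> 0}"
  define X where "X = space M - P"
  define s where "s = measure M X"
  have single: "{x} \<in> sets M" if "x \<in> space M" for x
  proof -
    have "{x} = c -` {c x} \<inter> space M" using inj that by (auto dest: inj_onD)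
    then show ?thesis by simp
  qed
  have cP: "countable P" by (rule countable_subset[OF _ countable_support]) (auto simp: P_def)
  have P [measurable]: "P \<in> sets M"
    using sets.countable[OF single cP] by (auto simp: P_def)
  have X [measurable]: "X \<in> sets M" unfolding X_def by simp
  have "iso_mod0 (restrict_space (completion M) X) (restrict_space (completion lborel) {0..s})"
  proof (cases "s = 0")
    case True
    \<comment> \<open>Purely atomic case: \<open>X\<close> and the single point of
      \<open>{0..0}\<close> are both null, so the empty bijection is an isomorphism modulo null
      sets.\<close>
    then have "X \<in> null_sets M" using X by (auto simp: s_def emeasure_eq_measure)
    then show ?thesis using True
      by (intro iso_mod0_completion[where A="{}" and B="{}" and f="\<lambda>_. 0"]) (auto simp: bij_betw_def)
  next
    case False
    then have s: "s > 0" by (simp add: s_def less_le)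
    then have eX: "emeasure M X = ennreal s" by (simp add: s_def emeasure_eq_measure)
    define U where "U = uniform_measure M X"
    have cU [measurable]: "c \<in> borel_measurable U" unfolding U_def by simp
    have psU: "prob_space U" unfolding U_def using s eX by (intro prob_space_uniform_measure) auto
    interpret U: prob_space U by fact
    have eU: "emeasure M (X \<inter> D) = ennreal s * emeasure U D" if "D \<in> sets M" for D
    proof -
      have "emeasure U D = emeasure M (X \<inter> D) / ennreal s"
        unfolding U_def using that by (simp add: eX)
      then show ?thesis using s by (simp add: ennreal_times_divide mult.commute[of "ennreal s"] mult_divide_eq_ennreal)
    qed
    define R where "R = distr U borel c"
    interpret R: cdf_distribution R
      unfolding cdf_distribution_def real_distribution_def real_distribution_axioms_def R_def
      by (auto intro!: U.prob_space_distr)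
    have atom: "measure R {y} = 0" for y
    proof -
      have "measure M (X \<inter> (c -` {y} \<inter> space M)) = 0"
      proof (cases "\<exists>x\<in>X. c x = y")
        case True
        then obtain x where x: "x \<in> X" "c x = y" by blast
        then have "X \<inter> (c -` {y} \<inter> space M) = {x}" using inj by (auto simp: X_def dest: inj_onD)
        then show ?thesis using x by (auto simp: X_def P_def)
      next
        case False
        then have "X \<inter> (c -` {y} \<inter> space M) = {}" by auto
        then show ?thesis by simp
      qed
      then have "ennreal s * emeasure U (c -` {y} \<inter> space M) = 0"
        by (subst eU[symmetric]) (auto simp: emeasure_eq_measure)
      then have "emeasure U (c -` {y} \<inter> space M) = 0" using s by auto
      then have "emeasure R {y} = 0" unfolding R_def by (subst emeasure_distr) (auto simp: U_def)
      then show ?thesis by (simp add: measure_def)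
    qed
    define F where "F = cdf R"
    have Fc: "isCont F y" for y unfolding F_def using R.isCont_cdf atom by blast
    have F [measurable]: "F \<in> borel_measurable borel" unfolding F_def by measurable
    \<comment> \<open>The quantile function of \<open>R\<close>, a generalised inverse of
      \<open>F\<close>; the value 0 outside (0, 1) is a dummy.\<close>
    define J where "J v = (if 0 < v \<and> v < 1 then Inf {x. v \<le> F x} else 0)" for v
    have Jle: "v \<le> F x \<longleftrightarrow> J v \<le> x" if "0 < v" "v < 1" for v x
      using R.pseudoinverse[of v x] that by (simp add: J_def F_def)
    \<comment> \<open>Here the absence of atoms enters: a jump of \<open>F\<close> would skip
      levels, and continuity excludes jumps.\<close>
    have FJ: "F (J v) = v" if v: "0 < v" "v < 1" for v
    proof (rule antisym)
      show "v \<le> F (J v)" using Jle[OF v, of "J v"] by simp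
      have "(\<lambda>n. F (J v - 1 / real (Suc n))) \<longlonglongrightarrow> F (J v - 0)"
        by (intro isCont_tendsto_compose[OF Fc] tendsto_intros LIMSEQ_Suc[OF lim_1_over_n])
      moreover have "F (J v - 1 / real (Suc n)) \<le> v" for n
        using Jle[OF v, of "J v - 1 / real (Suc n)"] by (auto simp: not_le)
      ultimately show "F (J v) \<le> v" by (intro LIMSEQ_le_const2) auto
    qed
    have J [measurable]: "J \<in> borel_measurable borel"
    proof -
      have "(\<lambda>v. if v \<in> {0<..<1} then Inf {x. v \<le> F x} else 0) \<in> borel_measurable borel"
        using R.measurable_CI by (subst measurable_restrict_space_iff[symmetric]) (auto simp: F_def)
      then show ?thesis by (simp add: J_def[abs_def])
    qed
    \<comment> \<open>Inverse transform sampling: a uniform variable on (0, 1) inserted into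
      \<open>J\<close> has law \<open>R\<close>.\<close>
    have RJ: "emeasure R D = emeasure lborel {v. 0 < v \<and> v < 1 \<and> J v \<in> D}" if [measurable]: "D \<in> sets borel" for D
    proof -
      have "emeasure R D = emeasure (distr (restrict_space lborel {0<..<1::real}) borel (\<lambda>v. Inf {x. v \<le> F x})) D"
        unfolding F_def using R.distr_I_eq_M by simp
      also have "\<dots> = emeasure (restrict_space lborel {0<..<1::real}) ((\<lambda>v. Inf {x. v \<le> F x}) -` D \<inter> {0<..<1})"
        using R.measurable_CI by (subst emeasure_distr) (auto simp: F_def space_restrict_space measurable_lborel1 cong: measurable_cong_sets sets_restrict_space_cong)
      also have "\<dots> = emeasure lborel ((\<lambda>v. Inf {x. v \<le> F x}) -` D \<inter> {0<..<1})"
        by (subst emeasure_restrict_space) auto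
      also have "(\<lambda>v. Inf {x. v \<le> F x}) -` D \<inter> {0<..<1} = {v. 0 < v \<and> v < 1 \<and> J v \<in> D}"
        by (auto simp: J_def)
      finally show ?thesis .
    qed
    have scale: "ennreal s * emeasure lborel {v. 0 < v \<and> v < 1 \<and> s * v \<in> D} = emeasure lborel (D \<inter> {0<..<s})"
      if [measurable]: "D \<in> sets borel" for D
    proof -
      have "emeasure lborel (D \<inter> {0<..<s}) = emeasure (density (distr lborel borel (\<lambda>x. 0 + s * x)) (\<lambda>_. ennreal \<bar>s\<bar>)) (D \<inter> {0<..<s})"
        using lborel_real_affine[of s 0] s by simp
      also have "\<dots> = ennreal s * emeasure (distr lborel borel (\<lambda>x. 0 + s * x)) (D \<inter> {0<..<s})"
        using s by (subst emeasure_density_const) auto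
      also have "emeasure (distr lborel borel (\<lambda>x. 0 + s * x)) (D \<inter> {0<..<s}) = emeasure lborel {v. 0 < v \<and> v < 1 \<and> s * v \<in> D}"
        using s by (subst emeasure_distr) (auto intro!: arg_cong2[where f=emeasure] simp: zero_less_mult_iff)
      finally show ?thesis by simp
    qed
    have eR: "emeasure R D = emeasure U (c -` D \<inter> space M)" if "D \<in> sets borel" for D
      unfolding R_def using that by (subst emeasure_distr) (auto simp: U_def)
    \<comment> \<open>\<open>F\<close> may be flat on intervals that \<open>R\<close> does not
      charge. \<open>A\<close> keeps the points recovered from their own level, \<open>B\<close> the
      rescaled levels whose quantile is the code of some point of \<open>X\<close>.\<close>
    define A where "A = {x \<in> X. 0 < F (c x) \<and> F (c x) < 1 \<and> J (F (c x)) = c x}"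
    define B where "B = {w. 0 < w \<and> w < s \<and> J (w / s) \<in> c ` X}"
    define f where "f x = s * F (c x)" for x
    have A [measurable]: "A \<in> sets M"
    proof -
      have "A = X \<inter> {x \<in> space M. 0 < F (c x) \<and> F (c x) < 1 \<and> J (F (c x)) = c x}"
        by (auto simp: A_def X_def)
      also have "\<dots> \<in> sets M" by measurable
      finally show ?thesis .
    qed
    have cX [measurable]: "c ` X \<in> sets borel" by (rule img) simp
    have B [measurable]: "B \<in> sets borel" unfolding B_def by measurable
    have AX: "A \<subseteq> X" by (auto simp: A_def)
    have B_sub: "B \<subseteq> {0..s}" by (auto simp: B_def)
    have XM: "X \<subseteq> space M" by (auto simp: X_def)
    have injA: "inj_on f A"
    proof (rule inj_onI)
      fix x y assume *: "x \<in> A" "y \<in> A" "f x = f y"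
      then have "F (c x) = F (c y)" using s by (simp add: f_def)
      then have "c x = c y" using * by (metis (mono_tags, lifting) A_def mem_Collect_eq)
      then show "x = y" using inj * AX XM by (meson inj_onD subsetD)
    qed
    have surj: "\<exists>x\<in>A. f x = w \<and> c x = J (w / s)" if w: "w \<in> B" for w
    proof -
      obtain x where x: "x \<in> X" "J (w / s) = c x" using w by (auto simp: B_def)
      have "F (c x) = w / s" using FJ[of "w / s"] w s x by (simp add: B_def)
      then show ?thesis using x w s by (intro bexI[of _ x]) (auto simp: f_def A_def B_def)
    qed
    have into: "f x \<in> B" if "x \<in> A" for x
      using that s by (auto simp: A_def B_def f_def)
    have bij: "bij_betw f A B"
      unfolding bij_betw_def using injA surj into by fastforce
    have pre: "f -` C \<inter> A \<in> sets M" if [measurable]: "C \<in> sets borel" for C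
    proof -
      have "f -` C \<inter> A = {x \<in> space M. s * F (c x) \<in> C} \<inter> A"
        using AX XM by (auto simp: f_def)
      also have "\<dots> \<in> sets M" by measurable
      finally show ?thesis .
    qed
    have em: "emeasure M (f -` C \<inter> A) = emeasure lborel C" if C [measurable]: "C \<in> sets borel" and CB: "C \<subseteq> B" for C
    proof -
      have [measurable]: "c ` (f -` C \<inter> A) \<in> sets borel" by (intro img pre C)
      have 1: "c -` (c ` (f -` C \<inter> A)) \<inter> space M = f -` C \<inter> A"
        using inj AX XM by (auto dest: inj_onD)
      have "emeasure M (f -` C \<inter> A) = emeasure M (X \<inter> (f -` C \<inter> A))"
        using AX by (intro arg_cong2[where f=emeasure]) auto
      also have "\<dots> = ennreal s * emeasure U (f -` C \<inter> A)" by (rule eU[OF pre[OF C]])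
      also have "emeasure U (f -` C \<inter> A) = emeasure R (c ` (f -` C \<inter> A))"
        by (subst eR) (simp_all add: 1)
      also have "\<dots> = emeasure lborel {v. 0 < v \<and> v < 1 \<and> J v \<in> c ` (f -` C \<inter> A)}"
        by (rule RJ) simp
      also have "{v. 0 < v \<and> v < 1 \<and> J v \<in> c ` (f -` C \<inter> A)} = {v. 0 < v \<and> v < 1 \<and> s * v \<in> C}"
      proof safe
        fix v x assume v: "0 < v" "v < 1" and x: "J v = c x" "x \<in> A" "f x \<in> C"
        then show "s * v \<in> C" using FJ[OF v] by (simp add: f_def)
      next
        fix v assume v: "0 < v" "v < 1" "s * v \<in> C"
        then obtain x where "x \<in> A" "f x = s * v" "c x = J (s * v / s)" using surj CB by blast
        then show "J v \<in> c ` (f -` C \<inter> A)" using v s by (intro image_eqI[of _ _ x]) auto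
      qed
      also have "ennreal s * emeasure lborel {v. 0 < v \<and> v < 1 \<and> s * v \<in> C} = emeasure lborel (C \<inter> {0<..<s})"
        by (rule scale) simp
      also have "C \<inter> {0<..<s} = C" using CB by (auto simp: B_def)
      finally show ?thesis .
    qed
    have imgf: "f ` C \<in> sets borel" if C [measurable]: "C \<in> sets M" and CA: "C \<subseteq> A" for C
    proof -
      have [measurable]: "c ` C \<in> sets borel" by (rule img) simp
      have "f ` C = {w. 0 < w \<and> w < s \<and> J (w / s) \<in> c ` C}"
      proof safe
        fix x assume "x \<in> C"
        then have "x \<in> A" using CA by auto
        then show "0 < f x" "f x < s" "J (f x / s) \<in> c ` C"
          using s \<open>x \<in> C\<close> by (auto simp: A_def f_def)
      next
        fix w x assume w: "0 < w" "w < s" "J (w / s) = c x" "x \<in> C"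
        have "F (c x) = w / s" using FJ[of "w / s"] w s by simp
        then show "w \<in> f ` C" using w s by (intro image_eqI[of _ _ x]) (auto simp: f_def)
      qed
      also have "\<dots> \<in> sets borel" by measurable
      finally show ?thesis .
    qed
    \<comment> \<open>Only \<open>B\<close> is measured directly, through \<open>RJ\<close>.
      Applying \<open>em\<close> to \<open>B\<close> itself then shows that \<open>A\<close> has
      full mass in \<open>X\<close>.\<close>
    have "emeasure lborel B = ennreal s * emeasure lborel {v. 0 < v \<and> v < 1 \<and> s * v \<in> B}"
      by (subst scale) (auto intro!: arg_cong2[where f=emeasure] simp: B_def)
    also have "{v. 0 < v \<and> v < 1 \<and> s * v \<in> B} = {v. 0 < v \<and> v < 1 \<and> J v \<in> c ` X}"
      using s by (auto simp: B_def)
    also have "emeasure lborel \<dots> = emeasure U (c -` (c ` X) \<inter> space M)"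
      by (subst RJ[symmetric]) (simp_all add: eR)
    also have "c -` (c ` X) \<inter> space M = X" using inj XM by (auto dest: inj_onD)
    also have "ennreal s * emeasure U X = emeasure M (X \<inter> X)" by (rule eU[symmetric]) simp
    finally have eB: "emeasure lborel B = ennreal s" by (simp add: eX)
    have eA: "emeasure M A = ennreal s"
      using em[OF B subset_refl] into eB by (simp add: Int_absorb1 subset_iff)
    have "emeasure M (X - A) = 0"
      using AX by (subst emeasure_Diff) (auto simp: eA eX)
    moreover have "emeasure lborel ({0..s} - B) = 0"
      using s eB B_sub by (subst emeasure_Diff) auto
    ultimately show ?thesis
      using AX B_sub bij pre em imgf
      by (intro iso_mod0_completion[where A=A and B=B and f=f]) (auto intro!: null_setsI)
  qed
  moreover have "P \<subseteq> space M" "\<forall>p\<in>P. {p} \<in> sets (completion M) \<and> emeasure (completion M) {p} > 0" "0 \<le> s"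
    by (auto simp: P_def s_def single emeasure_eq_measure less_le)
  ultimately show ?thesis
    unfolding Lebesgue_prob_space_def X_def using cP
    by (auto simp: prob_space_completion completion.complete_measure_axioms)
qed

section \<open>Weak compactness\<close>

text \<open>Sequential continuity with respect to pointwise convergence, which on \<^const>\<open>lip\<close> is the
  topology of locally uniform convergence.\<close>

definition pcont :: "((real \<Rightarrow> real) \<Rightarrow> real) \<Rightarrow> bool" where
  "pcont g \<longleftrightarrow> g \<in> borel_measurable lipM \<and> (\<exists>B. \<forall>x\<in>lip. \<bar>g x\<bar> \<le> B) \<and>
     (\<forall>x y. (\<forall>n. x n \<in> lip) \<and> y \<in> lip \<and> (\<forall>t. (\<lambda>n. x n t) \<longlonglongrightarrow> y t) \<longrightarrow> (\<lambda>n. g (x n)) \<longlonglongrightarrow> g y)"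

lemma pcontI:
  assumes "g \<in> borel_measurable lipM" "\<And>x. x \<in> lip \<Longrightarrow> \<bar>g x\<bar> \<le> B"
    and "\<And>x y. (\<And>n. x n \<in> lip) \<Longrightarrow> y \<in> lip \<Longrightarrow> (\<And>t. (\<lambda>n. x n t) \<longlonglongrightarrow> y t) \<Longrightarrow> (\<lambda>n. g (x n :: real \<Rightarrow> real)) \<longlonglongrightarrow> g y"
  shows "pcont g"
  unfolding pcont_def using assms by blast

lemma pcont_measurable: "pcont g \<Longrightarrow> g \<in> borel_measurable lipM"
  by (simp add: pcont_def)

lemma pcont_bounded: assumes "pcont g" obtains B where "\<And>x. x \<in> lip \<Longrightarrow> \<bar>g x\<bar> \<le> B" "B \<ge> 0"
proof -
  obtain B where B: "\<And>x. x \<in> lip \<Longrightarrow> \<bar>g x\<bar> \<le> B" using assms by (auto simp: pcont_def)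
  have "\<bar>g x\<bar> \<le> max B 0" if "x \<in> lip" for x using B[OF that] by simp
  then show ?thesis by (intro that[of "max B 0"]) auto
qed

lemma pcont_tendsto:
  assumes "pcont g" "\<And>n. x n \<in> lip" "y \<in> lip" "\<And>t. (\<lambda>n. x n t) \<longlonglongrightarrow> y t"
  shows "(\<lambda>n. g (x n)) \<longlonglongrightarrow> g y"
  using assms by (simp add: pcont_def)

lemma pcont_eval: "pcont (\<lambda>x. x t)"
  by (rule pcontI[where B=1]) (auto simp: lipD)

lemma pcont_const: "pcont (\<lambda>x. a)"
  by (rule pcontI[where B="\<bar>a\<bar>"]) auto

lemma pcont_compose:
  fixes \<phi> :: "real \<Rightarrow> real"
  assumes g: "pcont g" and c: "\<And>t. isCont \<phi> t"
  shows "pcont (\<lambda>x. \<phi> (g x))"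
proof -
  obtain B where B: "\<And>x. x \<in> lip \<Longrightarrow> \<bar>g x\<bar> \<le> B" using pcont_bounded[OF g] by blast
  have cont: "continuous_on A \<phi>" for A by (simp add: c continuous_at_imp_continuous_on)
  have "bounded (\<phi> ` {-B..B})" by (intro compact_imp_bounded compact_continuous_image cont) simp
  then obtain C where C: "\<And>t. t \<in> {-B..B} \<Longrightarrow> \<bar>\<phi> t\<bar> \<le> C" unfolding bounded_iff real_norm_def by blast
  show ?thesis
  proof (rule pcontI[where B=C])
    show "(\<lambda>x. \<phi> (g x)) \<in> borel_measurable lipM"
      by (rule measurable_compose[OF pcont_measurable[OF g] borel_measurable_continuous_onI[OF cont]])
    show "\<bar>\<phi> (g x)\<bar> \<le> C" if "x \<in> lip" for x using B[OF that] by (intro C) (auto simp: abs_le_iff)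
  qed (intro isCont_tendsto_compose[OF c] pcont_tendsto[OF g])
qed

lemma pcont_mult: assumes f: "pcont f" and g: "pcont g" shows "pcont (\<lambda>x. f x * g x)"
proof -
  obtain B where B: "\<And>x. x \<in> lip \<Longrightarrow> \<bar>f x\<bar> \<le> B" "B \<ge> 0" using pcont_bounded[OF f] by blast
  obtain C where C: "\<And>x. x \<in> lip \<Longrightarrow> \<bar>g x\<bar> \<le> C" "C \<ge> 0" using pcont_bounded[OF g] by blast
  note [measurable] = pcont_measurable[OF f] pcont_measurable[OF g]
  show ?thesis
    by (rule pcontI[where B="B * C"])
       (use B C in \<open>auto simp: abs_mult intro!: mult_mono tendsto_mult pcont_tendsto[OF f] pcont_tendsto[OF g]\<close>)
qed

lemma pcont_prod: "finite I \<Longrightarrow> (\<And>i. i \<in> I \<Longrightarrow> pcont (g i)) \<Longrightarrow> pcont (\<lambda>x. \<Prod>i\<in>I. g i x)"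
  by (induction I rule: finite_induct) (auto simp: pcont_const pcont_mult)

lemma integrable_bounded:
  fixes g :: "(real \<Rightarrow> real) \<Rightarrow> real"
  assumes "prob_space M" "sets M = sets lipM" "g \<in> borel_measurable lipM" "\<And>x. x \<in> lip \<Longrightarrow> \<bar>g x\<bar> \<le> B"
  shows "integrable M g"
proof -
  interpret prob_space M by fact
  have "space M = lip" using assms(2) by (metis sets_eq_imp_space_eq space_lipM)
  then show ?thesis
    using assms by (intro integrable_const_bound[where B=B]) (auto cong: measurable_cong_sets)
qed

lemma pcont_integrable: "prob_space M \<Longrightarrow> sets M = sets lipM \<Longrightarrow> pcont g \<Longrightarrow> integrable M g"
  by (metis integrable_bounded pcont_bounded pcont_measurable)

text \<open>Helly's selection theorem applies to the laws of the codes; Skorohod's theorem turns their weak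
  convergence into convergence of codes, which \<^const>\<open>decode\<close> preserves.\<close>

theorem weak_compactness:
  fixes \<mu> :: "nat \<Rightarrow> (real \<Rightarrow> real) measure"
  assumes ps: "\<And>n. prob_space (\<mu> n)" and sets: "\<And>n. sets (\<mu> n) = sets lipM"
  shows "\<exists>r \<nu>. strict_mono (r :: nat \<Rightarrow> nat) \<and> prob_space \<nu> \<and> sets \<nu> = sets lipM \<and>
    (\<forall>g. pcont g \<longrightarrow> (\<lambda>n. \<integral>x. g x \<partial>\<mu> (r n)) \<longlonglongrightarrow> (\<integral>x. g x \<partial>\<nu>))"
proof -
  have sp: "space (\<mu> n) = lip" for n using sets by (metis sets_eq_imp_space_eq space_lipM)
  note [measurable_cong] = sets
  define \<rho> where "\<rho> n = distr (\<mu> n) borel code" for n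
  have psr: "prob_space (\<rho> n)" for n unfolding \<rho>_def by (intro prob_space.prob_space_distr ps) simp
  have rd: "real_distribution (\<rho> n)" for n
    using psr by (auto simp: real_distribution_def real_distribution_axioms_def \<rho>_def)
  have "tight \<rho>"
    unfolding tight_def
  proof (intro conjI allI impI rd)
    fix e :: real assume "e > 0"
    \<comment> \<open>Codes lie in [0, 1]. The interval is open on the left, so it has to start
      below 0, which is a possible code.\<close>
    have "measure (\<rho> n) {-1<..1} = 1" for n
    proof -
      have "measure (\<rho> n) {-1<..1} = measure (\<mu> n) (code -` {-1<..1} \<inter> lip)"
        unfolding \<rho>_def by (subst measure_distr) (auto simp: sp)
      also have "code -` {-1<..1} \<inter> lip = space (\<mu> n)"
        using less_le_trans[OF _ code_bounds(1), of "-1"] code_bounds(2) by (auto simp: sp)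
      finally show ?thesis using prob_space.prob_space[OF ps] by simp
    qed
    then show "\<exists>a b. a < b \<and> (\<forall>n. 1 - e < measure (\<rho> n) {a<..b})"
      using \<open>e > 0\<close> by (intro exI[of _ "-1"] exI[of _ 1]) auto
  qed
  from tight_imp_convergent_subsubsequence[OF this, of id]
  obtain r \<rho>' where r: "strict_mono r" and rd': "real_distribution \<rho>'" and wc: "weak_conv_m (\<lambda>n. \<rho> (r n)) \<rho>'"
    by (auto simp: strict_mono_def o_def)
  obtain \<Omega> :: "real measure" and Y Z where om: "prob_space \<Omega>"
    and Y [measurable]: "\<And>n. Y n \<in> borel_measurable \<Omega>" and dY: "\<And>n. distr \<Omega> borel (Y n) = \<rho> (r n)"
    and Z0: "Z \<in> measurable \<Omega> lborel" and lim: "\<And>\<omega>. \<omega> \<in> space \<Omega> \<Longrightarrow> (\<lambda>n. Y n \<omega>) \<longlonglongrightarrow> Z \<omega>"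
    using Skorohod[OF rd rd' wc] by metis
  have Z [measurable]: "Z \<in> borel_measurable \<Omega>" using Z0 by simp
  interpret prob_space \<Omega> by fact
  define \<nu> where "\<nu> = distr \<Omega> lipM (\<lambda>\<omega>. decode (Z \<omega>))"
  \<comment> \<open>Only the approximants are almost surely codes. The limit \<open>Z\<close> may
    miss the codes with positive probability, a case that \<open>decode_tendsto\<close>
    covers.\<close>
  have ae: "AE \<omega> in \<Omega>. Y n \<omega> \<in> code ` lip" for n
  proof -
    have "AE y in \<rho> (r n). y \<in> code ` lip"
      unfolding \<rho>_def using code_range_borel by (subst AE_distr_iff) (auto simp: sp)
    then show ?thesis
      unfolding dY[symmetric] using code_range_borel by (subst (asm) AE_distr_iff) auto
  qed
  show ?thesis
  proof (intro exI[of _ r] exI[of _ \<nu>] conjI allI impI r)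
    show "prob_space \<nu>" unfolding \<nu>_def by (intro prob_space_distr) simp
    show "sets \<nu> = sets lipM" by (simp add: \<nu>_def)
    fix g assume g: "pcont g"
    note [measurable] = pcont_measurable[OF g]
    obtain B where B: "\<And>x. x \<in> lip \<Longrightarrow> \<bar>g x\<bar> \<le> B" using pcont_bounded[OF g] by blast
    have 1: "(\<integral>x. g x \<partial>\<mu> (r n)) = (\<integral>\<omega>. g (decode (Y n \<omega>)) \<partial>\<Omega>)" for n
    proof -
      have "(\<integral>x. g x \<partial>\<mu> (r n)) = (\<integral>x. g (decode (code x)) \<partial>\<mu> (r n))"
        by (intro Bochner_Integration.integral_cong) (auto simp: sp decode_code)
      also have "\<dots> = (\<integral>y. g (decode y) \<partial>\<rho> (r n))"
        unfolding \<rho>_def by (subst integral_distr) auto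
      also have "\<dots> = (\<integral>\<omega>. g (decode (Y n \<omega>)) \<partial>\<Omega>)"
        unfolding dY[symmetric] by (subst integral_distr) auto
      finally show ?thesis .
    qed
    have "(\<lambda>n. \<integral>\<omega>. g (decode (Y n \<omega>)) \<partial>\<Omega>) \<longlonglongrightarrow> (\<integral>\<omega>. g (decode (Z \<omega>)) \<partial>\<Omega>)"
    proof (rule integral_dominated_convergence[where w="\<lambda>_. B"])
      have "AE \<omega> in \<Omega>. \<forall>n. Y n \<omega> \<in> code ` lip" using ae by (simp add: AE_all_countable)
      then show "AE \<omega> in \<Omega>. (\<lambda>n. g (decode (Y n \<omega>))) \<longlonglongrightarrow> g (decode (Z \<omega>))"
      proof (rule AE_mp, intro AE_I2 impI)
        fix \<omega> assume "\<omega> \<in> space \<Omega>" "\<forall>n. Y n \<omega> \<in> code ` lip"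
        then show "(\<lambda>n. g (decode (Y n \<omega>))) \<longlonglongrightarrow> g (decode (Z \<omega>))"
          by (intro pcont_tendsto[OF g] decode_lip decode_tendsto lim) auto
      qed
    qed (use B decode_lip in auto)
    then show "(\<lambda>n. \<integral>x. g x \<partial>\<mu> (r n)) \<longlonglongrightarrow> (\<integral>x. g x \<partial>\<nu>)"
      unfolding 1 \<nu>_def by (subst integral_distr) auto
  qed
qed

text \<open>Continuous functions that increase with \<open>j\<close> to the indicator of an open
  cylinder. Restricting positions and thresholds to rationals leaves countably many of them, so that
  they can be summed in \<open>energy\<close>.\<close>

definition bump :: "(rat \<times> rat) set \<times> nat \<Rightarrow> (real \<Rightarrow> real) \<Rightarrow> real" where
  "bump = (\<lambda>(F, j) x. \<Prod>(q, r)\<in>F. max 0 (min 1 (real j * (of_rat r - x (of_rat q)))))"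

lemma bump_pcont: assumes "finite F" shows "pcont (bump (F, j))"
proof -
  have "pcont (\<lambda>x. \<Prod>p\<in>F. max 0 (min 1 (real j * (of_rat (snd p) - x (of_rat (fst p))))))"
    by (intro pcont_prod assms pcont_compose[OF pcont_eval, where \<phi>="\<lambda>t. max 0 (min 1 (real j * (of_rat _ - t)))"] continuous_intros)
  then show ?thesis by (simp add: bump_def split_beta')
qed

lemma bump_bounds: "0 \<le> bump p x" "bump p x \<le> 1"
  unfolding bump_def by (auto split: prod.split intro!: prod_nonneg prod_le_1)

lemma bump_tendsto:
  assumes "finite F"
  shows "(\<lambda>j. bump (F, j) x) \<longlonglongrightarrow> indicator {x. \<forall>(q, r)\<in>F. x (of_rat q) < of_rat r} x"
proof -
  have one: "(\<lambda>j. max 0 (min 1 (real j * a))) \<longlonglongrightarrow> (if a > 0 then 1 else 0)" for a :: real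
  proof (cases "a > 0")
    case True
    have "\<forall>\<^sub>F j in sequentially. max 0 (min 1 (real j * a)) = 1"
    proof (rule eventually_sequentiallyI[of "nat \<lceil>1 / a\<rceil>"])
      fix j assume "nat \<lceil>1 / a\<rceil> \<le> j"
      then have "1 / a \<le> real j" by linarith
      then show "max 0 (min 1 (real j * a)) = 1" using True by (simp add: field_simps)
    qed
    then show ?thesis using True by (simp add: tendsto_eventually)
  next
    case False
    then have "real j * a \<le> 0" for j by (simp add: mult_nonneg_nonpos)
    then have "max 0 (min 1 (real j * a)) = 0" for j by (simp add: min.coboundedI2)
    then show ?thesis using False by simp
  qed
  have "(\<lambda>j. \<Prod>p\<in>F. max 0 (min 1 (real j * (of_rat (snd p) - x (of_rat (fst p)))))) \<longlonglongrightarrow>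
      (\<Prod>p\<in>F. if of_rat (snd p) - x (of_rat (fst p)) > 0 then 1 else 0 :: real)"
    by (intro tendsto_prod one)
  also have "(\<Prod>p\<in>F. if of_rat (snd p) - x (of_rat (fst p)) > 0 then 1 else 0 :: real) =
      indicator {x. \<forall>(q, r)\<in>F. x (of_rat q) < of_rat r} x"
  proof (cases "\<forall>p\<in>F. x (of_rat (fst p)) < of_rat (snd p)")
    case True
    then show ?thesis by (auto simp: indicator_def intro!: prod.neutral)
  next
    case False
    then have "\<exists>p\<in>F. (if of_rat (snd p) - x (of_rat (fst p)) > 0 then 1 else 0 :: real) = 0" by auto
    then have "(\<Prod>p\<in>F. if of_rat (snd p) - x (of_rat (fst p)) > 0 then 1 else 0 :: real) = 0"
      by (intro prod_zero assms)
    then show ?thesis using False by (simp add: indicator_def split_beta')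
  qed
  finally show ?thesis by (simp add: bump_def split_beta')
qed

definition cyl :: "(rat \<times> rat) set \<Rightarrow> (real \<Rightarrow> real) set" where
  "cyl F = {x \<in> lip. \<forall>(q, r)\<in>F. x (of_rat q) < of_rat r}"

lemma cyl_sets [measurable]: "finite F \<Longrightarrow> cyl F \<in> sets lipM"
proof (induction F rule: finite_induct)
  case empty
  have "cyl {} = space lipM" by (simp add: cyl_def)
  then show ?case by (metis sets.top)
next
  case (insert p F)
  have "cyl (insert p F) = {x \<in> space lipM. x (of_rat (fst p)) < of_rat (snd p)} \<inter> cyl F"
    by (auto simp: cyl_def)
  also have "\<dots> \<in> sets lipM" using insert.IH by measurable
  finally show ?case .
qed

text \<open>By continuity every coordinate is a pointwise limit of rational coordinates, so strict
  rational bounds at rational times generate everything.\<close>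

lemma sets_lipM_cyl: "sets lipM = sigma_sets lip (cyl ` {F. finite F})"
proof
  have sub: "cyl ` {F. finite F} \<subseteq> Pow lip" by (auto simp: cyl_def)
  show "sigma_sets lip (cyl ` {F. finite F}) \<subseteq> sets lipM"
    using sets.sigma_sets_subset[of "cyl ` {F. finite F}" lipM] cyl_sets unfolding space_lipM by blast
  define S where "S = sigma lip (cyl ` {F. finite F})"
  have sS: "space S = lip" "sets S = sigma_sets lip (cyl ` {F. finite F})"
    using sub by (auto simp: S_def)
  have rat: "(\<lambda>x. x (of_rat q)) \<in> borel_measurable S" for q
  proof (rule borel_measurableI_less)
    fix y
    have "{x \<in> space S. x (of_rat q) < y} = (\<Union>r\<in>{r. of_rat r \<le> y}. cyl {(q, r)})"
    proof safe
      fix x assume "x \<in> space S" "x (of_rat q) < y"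
      moreover then obtain r where "x (of_rat q) < of_rat r" "of_rat r < y" using of_rat_dense by blast
      ultimately show "x \<in> (\<Union>r\<in>{r. of_rat r \<le> y}. cyl {(q, r)})"
        by (auto simp: sS cyl_def intro!: exI[of _ r])
    qed (auto simp: sS cyl_def)
    also have "\<dots> \<in> sets S" by (intro sets.countable_UN'') (auto simp: sS)
    finally show "{x \<in> space S. x (of_rat q) < y} \<in> sets S" .
  qed
  have "(\<lambda>x. x) \<in> S \<rightarrow>\<^sub>M lipM"
  proof (rule measurable_lipM)
    fix t
    have "\<exists>q :: nat \<Rightarrow> rat. \<forall>n. \<bar>of_rat (q n) - t\<bar> < 1 / real (Suc n)"
    proof (intro choice allI)
      fix n
      obtain q where "t < real_of_rat q" "real_of_rat q < t + 1 / real (Suc n)"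
        using of_rat_dense[of t "t + 1 / real (Suc n)"] by auto
      then show "\<exists>q. \<bar>real_of_rat q - t\<bar> < 1 / real (Suc n)" by (intro exI[of _ q]) auto
    qed
    then obtain q :: "nat \<Rightarrow> rat" where q: "\<And>n. \<bar>of_rat (q n) - t\<bar> < 1 / real (Suc n)" by blast
    have "(\<lambda>n. of_rat (q n) - t) \<longlonglongrightarrow> 0"
      by (rule Lim_null_comparison[OF _ LIMSEQ_Suc[OF lim_1_over_n]])
         (use q in \<open>auto intro!: always_eventually less_imp_le\<close>)
    then have ql: "(\<lambda>n. of_rat (q n)) \<longlonglongrightarrow> t" by (simp add: LIM_zero_iff)
    show "(\<lambda>x. x t) \<in> borel_measurable S"
      by (rule borel_measurable_LIMSEQ_real[where u="\<lambda>n x. x (of_rat (q n))"])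
         (auto simp: sS rat intro!: isCont_tendsto_compose[OF lip_continuous ql])
  qed (simp add: sS)
  then show "sets lipM \<subseteq> sigma_sets lip (cyl ` {F. finite F})"
    unfolding sS(2)[symmetric] using measurable_sets[of "\<lambda>x. x" S lipM] sets.sets_into_space[of _ lipM]
    by (auto simp: sS(1) Int_absorb2)
qed

lemma cyl_Int: "cyl F \<inter> cyl G = cyl (F \<union> G)"
  by (auto simp: cyl_def)

text \<open>As \<open>j\<close> grows the integrals tend to the masses of the cylinders, and these
  form a generator closed under intersection.\<close>

lemma measure_eqI_bump:
  assumes M: "prob_space M" "sets M = sets lipM" and N: "prob_space N" "sets N = sets lipM"
    and eq: "\<And>F j. finite F \<Longrightarrow> (\<integral>x. bump (F, j) x \<partial>M) = (\<integral>x. bump (F, j) x \<partial>N)"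
  shows "M = N"
proof -
  interpret M: prob_space M by fact
  interpret N: prob_space N by fact
  have sp: "space M = lip" "space N = lip" using M N by (metis sets_eq_imp_space_eq space_lipM)+
  have lim: "(\<lambda>j. \<integral>x. bump (F, j) x \<partial>K) \<longlonglongrightarrow> measure K (cyl F)"
    if K: "prob_space K" "sets K = sets lipM" and F: "finite F" for K F
  proof -
    interpret K: prob_space K by fact
    have spK: "space K = lip" using K by (metis sets_eq_imp_space_eq space_lipM)
    have [measurable]: "bump (F, j) \<in> borel_measurable K" "cyl F \<in> sets K" for j
      using pcont_measurable[OF bump_pcont[OF F]] cyl_sets[OF F] K(2) by (auto cong: measurable_cong_sets)
    have "(\<lambda>j. \<integral>x. bump (F, j) x \<partial>K) \<longlonglongrightarrow> (\<integral>x. indicator (cyl F) x \<partial>K)"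
    proof (rule integral_dominated_convergence[where w="\<lambda>_. 1"])
      show "AE x in K. (\<lambda>j. bump (F, j) x) \<longlonglongrightarrow> indicator (cyl F) x"
      proof (rule AE_I2)
        fix x assume "x \<in> space K"
        then have "indicator (cyl F) x = (indicator {x. \<forall>(q, r)\<in>F. x (of_rat q) < of_rat r} x :: real)"
          by (auto simp: indicator_def cyl_def spK)
        then show "(\<lambda>j. bump (F, j) x) \<longlonglongrightarrow> indicator (cyl F) x" using bump_tendsto[OF F] by simp
      qed
    qed (use bump_bounds in \<open>auto simp: abs_le_iff intro: order.trans[of _ 0]\<close>)
    then show ?thesis by simp
  qed
  show ?thesis
  proof (rule measure_eqI_generator_eq[where E="cyl ` {F. finite F}" and \<Omega>=lip and A="\<lambda>_. lip"])
    show "Int_stable (cyl ` {F. finite F})"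
      by (auto simp: Int_stable_def cyl_Int)
    show "cyl ` {F. finite F} \<subseteq> Pow lip" by (auto simp: cyl_def)
    show "sets M = sigma_sets lip (cyl ` {F. finite F})" "sets N = sigma_sets lip (cyl ` {F. finite F})"
      using M N by (simp_all add: sets_lipM_cyl)
    have "lip = cyl {}" by (simp add: cyl_def)
    then show "range (\<lambda>_. lip) \<subseteq> cyl ` {F. finite F}" by auto
    show "emeasure M lip \<noteq> \<infinity>" using M.emeasure_space_1 sp by simp
    fix A assume "A \<in> cyl ` {F. finite F}"
    then obtain F where F: "finite F" "A = cyl F" by auto
    have "measure M (cyl F) = measure N (cyl F)"
      using LIMSEQ_unique[OF lim[OF M F(1)]] lim[OF N F(1)] eq[OF F(1)] by simp
    then show "emeasure M A = emeasure N A" by (simp add: M.emeasure_eq_measure N.emeasure_eq_measure F)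
  qed auto
qed

section \<open>Invariant measures on an orbit closure\<close>

definition shift_fun :: "real \<Rightarrow> (real \<Rightarrow> real) \<Rightarrow> real \<Rightarrow> real" where
  "shift_fun u x t = x (t + u)"

lemma shift_fun_lip: "x \<in> lip \<Longrightarrow> shift_fun u x \<in> lip"
  unfolding lip_def shift_fun_def by (auto simp: algebra_simps) (metis add_diff_cancel_right)

lemma shift_fun_shift_fun: "shift_fun s (shift_fun t x) = shift_fun (s + t) x"
  by (auto simp: shift_fun_def fun_eq_iff algebra_simps)

lemma shift_fun_0 [simp]: "shift_fun 0 x = x"
  by (auto simp: shift_fun_def)

lemma shift_fun_measurable [measurable]: "shift_fun u \<in> lipM \<rightarrow>\<^sub>M lipM"
  by (rule measurable_lipM, simp add: shift_fun_def, simp add: shift_fun_lip)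

lemma shift_fun_bij: "bij_betw (shift_fun u) lip lip"
  by (rule bij_betw_byWitness[where f'="shift_fun (-u)"]) (auto simp: shift_fun_shift_fun shift_fun_lip)

lemma pcont_shift_fun: assumes "pcont g" shows "pcont (\<lambda>x. g (shift_fun u x))"
proof -
  obtain B where B: "\<And>x. x \<in> lip \<Longrightarrow> \<bar>g x\<bar> \<le> B" using pcont_bounded[OF assms] by blast
  show ?thesis
  proof (rule pcontI[where B=B])
    show "(\<lambda>x. g (shift_fun u x)) \<in> borel_measurable lipM"
      by (rule measurable_compose[OF shift_fun_measurable pcont_measurable[OF assms]])
    fix x y assume "\<And>n. x n \<in> lip" "y \<in> lip" "\<And>t. (\<lambda>n. (x n :: real \<Rightarrow> real) t) \<longlonglongrightarrow> y t"
    then show "(\<lambda>n. g (shift_fun u (x n))) \<longlonglongrightarrow> g (shift_fun u y)"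
      by (intro pcont_tendsto[OF assms] shift_fun_lip) (auto simp: shift_fun_def)
  qed (use B shift_fun_lip in auto)
qed

text \<open>A Caratheodory argument: rounding time down to a grid of step 1/(n+1) leaves countably
  many measurable cases, and continuity of the points of \<open>lip\<close> lets the mesh tend to
  0.\<close>

lemma shift_fun_joint_measurable: "(\<lambda>(t, x). shift_fun t x) \<in> borel \<Otimes>\<^sub>M lipM \<rightarrow>\<^sub>M lipM"
proof (rule measurable_lipM)
  fix s :: real
  have m: "(\<lambda>p. snd p (s + of_int \<lfloor>real (Suc n) * fst p\<rfloor> / real (Suc n))) \<in> borel_measurable (borel \<Otimes>\<^sub>M lipM)" for n
    by (rule measurable_compose_countable[where f="\<lambda>i p. snd p (s + of_int i / real (Suc n))" and g="\<lambda>p. \<lfloor>real (Suc n) * fst p\<rfloor>"])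
       (auto intro: measurable_compose[OF measurable_snd] measurable_compose[OF _ measurable_real_floor])
  have lim: "(\<lambda>n. s + of_int \<lfloor>real (Suc n) * t\<rfloor> / real (Suc n)) \<longlonglongrightarrow> s + t" for t :: real
  proof -
    have "(\<lambda>n. of_int \<lfloor>real (Suc n) * t\<rfloor> / real (Suc n) - t) \<longlonglongrightarrow> 0"
    proof (rule Lim_null_comparison[OF _ LIMSEQ_Suc[OF lim_1_over_n]], rule always_eventually, rule allI)
      fix n
      have "of_int \<lfloor>real (Suc n) * t\<rfloor> / real (Suc n) - t = (of_int \<lfloor>real (Suc n) * t\<rfloor> - real (Suc n) * t) / real (Suc n)"
        by (simp add: field_simps)
      moreover have "\<bar>of_int \<lfloor>real (Suc n) * t\<rfloor> - real (Suc n) * t\<bar> \<le> 1" by linarith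
      ultimately show "norm (of_int \<lfloor>real (Suc n) * t\<rfloor> / real (Suc n) - t) \<le> 1 / real (Suc n)"
        by (simp add: divide_right_mono del: of_nat_Suc)
    qed
    then show ?thesis by (intro tendsto_add tendsto_const) (simp add: LIM_zero_iff)
  qed
  have "(\<lambda>p. snd p (s + fst p)) \<in> borel_measurable (borel \<Otimes>\<^sub>M lipM)"
  proof (rule borel_measurable_LIMSEQ_real[OF _ m])
    fix p :: "real \<times> (real \<Rightarrow> real)"
    assume "p \<in> space (borel \<Otimes>\<^sub>M lipM)"
    then have "snd p \<in> lip" by (auto simp: space_pair_measure)
    then show "(\<lambda>n. snd p (s + of_int \<lfloor>real (Suc n) * fst p\<rfloor> / real (Suc n))) \<longlonglongrightarrow> snd p (s + fst p)"
      by (rule isCont_tendsto_compose[OF lip_continuous lim])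
  qed
  then show "(\<lambda>p. (case p of (t, x) \<Rightarrow> shift_fun t x) s) \<in> borel_measurable (borel \<Otimes>\<^sub>M lipM)"
    by (simp add: split_beta' shift_fun_def)
qed (auto simp: space_pair_measure shift_fun_lip)

text \<open>The last clause says that the measure lives on the orbit closure of \<open>f\<close>. In this form it
  passes to weak limits and to absolutely continuous measures without any topology on
  \<^const>\<open>lip\<close>.\<close>

definition hull_measures :: "(real \<Rightarrow> real) \<Rightarrow> (real \<Rightarrow> real) measure set" where
  "hull_measures f = {\<nu>. prob_space \<nu> \<and> sets \<nu> = sets lipM \<and> (\<forall>t. distr \<nu> lipM (shift_fun t) = \<nu>) \<and>
     (\<forall>g. pcont g \<and> (\<forall>x\<in>lip. 0 \<le> g x) \<and> (\<forall>s. g (shift_fun s f) = 0) \<longrightarrow> (\<integral>x. g x \<partial>\<nu>) = 0)}"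

lemma hull_measuresD:
  assumes "\<nu> \<in> hull_measures f"
  shows "prob_space \<nu>" "sets \<nu> = sets lipM" "distr \<nu> lipM (shift_fun t) = \<nu>" "space \<nu> = lip"
    "pcont g \<Longrightarrow> (\<And>x. x \<in> lip \<Longrightarrow> 0 \<le> g x) \<Longrightarrow> (\<And>s. g (shift_fun s f) = 0) \<Longrightarrow> (\<integral>x. g x \<partial>\<nu>) = 0"
proof -
  show "sets \<nu> = sets lipM" using assms by (simp add: hull_measures_def)
  then show "space \<nu> = lip" by (metis sets_eq_imp_space_eq space_lipM)
qed (use assms in \<open>auto simp: hull_measures_def\<close>)

text \<open>Invariance is asked only asymptotically, so that the lemma serves empirical measures,
  which are nearly invariant, as well as sequences inside \<open>hull_measures f\<close>. Bumps
  suffice to recognise the limit as invariant.\<close>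

lemma limit_in_hull_measures:
  assumes \<nu>: "prob_space \<nu>" "sets \<nu> = sets lipM"
    and lim: "\<And>g. pcont g \<Longrightarrow> (\<lambda>n. \<integral>x. g x \<partial>\<mu> n) \<longlonglongrightarrow> (\<integral>x. g x \<partial>\<nu>)"
    and inv: "\<And>g t. pcont g \<Longrightarrow> (\<lambda>n. (\<integral>x. g (shift_fun t x) \<partial>\<mu> n) - (\<integral>x. g x \<partial>\<mu> n)) \<longlonglongrightarrow> 0"
    and orb: "\<And>g n. pcont g \<Longrightarrow> (\<And>x. x \<in> lip \<Longrightarrow> 0 \<le> g x) \<Longrightarrow> (\<And>s. g (shift_fun s f) = 0) \<Longrightarrow> (\<integral>x. g x \<partial>\<mu> n) = 0"
  shows "\<nu> \<in> hull_measures f"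
proof -
  note [measurable_cong] = \<nu>(2)
  have "distr \<nu> lipM (shift_fun t) = \<nu>" for t
  proof (rule measure_eqI_bump)
    show "prob_space (distr \<nu> lipM (shift_fun t))" by (rule prob_space.prob_space_distr[OF \<nu>(1)]) simp
    fix F :: "(rat \<times> rat) set" and j assume F: "finite F"
    note b = bump_pcont[OF F, of j]
    note [measurable] = pcont_measurable[OF b]
    have "(\<integral>x. bump (F, j) x \<partial>distr \<nu> lipM (shift_fun t)) = (\<integral>x. bump (F, j) (shift_fun t x) \<partial>\<nu>)"
      by (subst integral_distr) auto
    moreover have "(\<integral>x. bump (F, j) (shift_fun t x) \<partial>\<nu>) - (\<integral>x. bump (F, j) x \<partial>\<nu>) = 0"
      by (rule LIMSEQ_unique[OF tendsto_diff[OF lim[OF pcont_shift_fun[OF b]] lim[OF b]] inv[OF b]])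
    ultimately show "(\<integral>x. bump (F, j) x \<partial>distr \<nu> lipM (shift_fun t)) = (\<integral>x. bump (F, j) x \<partial>\<nu>)" by simp
  qed (use \<nu> in auto)
  moreover have "(\<integral>x. g x \<partial>\<nu>) = 0" if "pcont g" "\<And>x. x \<in> lip \<Longrightarrow> 0 \<le> g x" "\<And>s. g (shift_fun s f) = 0" for g
    using LIMSEQ_unique[OF lim[OF that(1)]] orb[OF that] by simp
  ultimately show ?thesis using \<nu> by (auto simp: hull_measures_def)
qed

section \<open>Upper semicontinuity of the mass of the target set\<close>

definition peak :: "(real \<Rightarrow> real) set" where
  "peak = {x \<in> lip. x 0 = 1}"

lemma peak_sets [measurable]: "peak \<in> sets lipM"
proof -
  have "{x \<in> space lipM. x 0 = 1} \<in> sets lipM" by measurable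
  then show ?thesis by (simp add: peak_def)
qed

text \<open>The powers \<open>x 0 ^ j\<close> are continuous majorants of the indicator of
  \<open>peak\<close> and decrease to it, since the values lie in [0, 1]. The weak limit is taken
  for fixed \<open>j\<close>, and only afterwards does \<open>j\<close> tend to infinity.\<close>

lemma peak_upper_semicontinuous:
  assumes \<nu>: "prob_space \<nu>" "sets \<nu> = sets lipM"
    and \<mu>: "\<And>n. prob_space (\<mu> n)" "\<And>n. sets (\<mu> n) = sets lipM"
    and lim: "\<And>g. pcont g \<Longrightarrow> (\<lambda>n. \<integral>x. g x \<partial>\<mu> n) \<longlonglongrightarrow> (\<integral>x. g x \<partial>\<nu>)"
    and a: "a \<longlonglongrightarrow> b" "\<And>n. a n \<le> measure (\<mu> n) peak"
  shows "b \<le> measure \<nu> peak"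
proof -
  interpret prob_space \<nu> by fact
  have sp: "space \<nu> = lip" using \<nu>(2) by (metis sets_eq_imp_space_eq space_lipM)
  note [measurable_cong] = \<nu>(2) \<mu>(2)
  have pc: "pcont (\<lambda>x. x 0 ^ j)" for j
    by (rule pcont_compose[OF pcont_eval]) (intro continuous_intros)
  have "b \<le> (\<integral>x. x 0 ^ j \<partial>\<nu>)" for j
  proof (rule LIMSEQ_le[OF a(1) lim[OF pc]], intro exI[of _ 0] allI impI)
    fix n
    interpret m: prob_space "\<mu> n" by (rule \<mu>)
    have spm: "space (\<mu> n) = lip" using \<mu>(2) by (metis sets_eq_imp_space_eq space_lipM)
    have [measurable]: "peak \<in> sets (\<mu> n)" using \<mu>(2) by simp
    have "a n \<le> (\<integral>x. indicator peak x \<partial>\<mu> n)" using a(2)[of n] by simp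
    also have "\<dots> \<le> (\<integral>x. x 0 ^ j \<partial>\<mu> n)"
    proof (rule integral_mono)
      show "integrable (\<mu> n) (\<lambda>x. x 0 ^ j)" by (rule pcont_integrable[OF \<mu> pc])
      show "indicator peak x \<le> x 0 ^ j" if "x \<in> space (\<mu> n)" for x
        using that lipD(1)[of x 0] by (auto simp: spm indicator_def peak_def)
    qed (intro integrable_real_indicator, auto simp: m.emeasure_eq_measure)
    finally show "a n \<le> (\<integral>x. x 0 ^ j \<partial>\<mu> n)" .
  qed
  moreover have "(\<lambda>j. \<integral>x. x 0 ^ j \<partial>\<nu>) \<longlonglongrightarrow> (\<integral>x. indicator peak x \<partial>\<nu>)"
  proof (rule integral_dominated_convergence[where w="\<lambda>_. 1"])
    have [measurable]: "peak \<in> sets \<nu>" using \<nu>(2) by simp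
    show "indicator peak \<in> borel_measurable \<nu>" by simp
    show "(\<lambda>x. x 0 ^ j) \<in> borel_measurable \<nu>" for j by measurable
    show "AE x in \<nu>. (\<lambda>j. x 0 ^ j) \<longlonglongrightarrow> indicator peak x"
    proof (rule AE_I2)
      fix x assume "x \<in> space \<nu>"
      then show "(\<lambda>j. x 0 ^ j) \<longlonglongrightarrow> indicator peak x"
        using lipD(1,2)[of x 0] by (cases "x 0 = 1") (auto simp: sp peak_def intro!: LIMSEQ_power_zero)
    qed
    show "AE x in \<nu>. norm (x 0 ^ j) \<le> 1" for j
      using lipD(1,2)[of _ 0] by (auto simp: sp intro!: AE_I2 power_le_one)
  qed simp
  ultimately show ?thesis
    using LIMSEQ_le_const[of "\<lambda>j. \<integral>x. x 0 ^ j \<partial>\<nu>"] by (simp add: \<nu>(2))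
qed

text \<open>Lists stand in for finite sets because they form a countable type, which
  \<open>from_nat\<close> enumerates; repetitions are harmless.\<close>

abbreviation bmp :: "nat \<Rightarrow> (real \<Rightarrow> real) \<Rightarrow> real" where
  "bmp n \<equiv> bump (case from_nat n of (l, j) \<Rightarrow> (set l, j))"

text \<open>Squares of affine functions of the measure give convexity, which is strict because the
  bumps separate measures. The geometric weights make the sum continuous under weak
  convergence.\<close>

definition energy :: "(real \<Rightarrow> real) measure \<Rightarrow> real" where
  "energy \<nu> = (\<Sum>n. (1/2) ^ n * (\<integral>x. bmp n x \<partial>\<nu>)\<^sup>2)"

lemma bmp_pcont: "pcont (bmp n)"
  by (auto split: prod.split intro: bump_pcont)

lemma bmp_integral_bounds:
  assumes "prob_space \<nu>" "sets \<nu> = sets lipM"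
  shows "0 \<le> (\<integral>x. bmp n x \<partial>\<nu>)" "(\<integral>x. bmp n x \<partial>\<nu>) \<le> 1"
proof -
  interpret prob_space \<nu> by fact
  show "0 \<le> (\<integral>x. bmp n x \<partial>\<nu>)" by (simp add: bump_bounds)
  have "(\<integral>x. bmp n x \<partial>\<nu>) \<le> (\<integral>x. 1 \<partial>\<nu>)"
    by (intro integral_mono pcont_integrable[OF assms bmp_pcont]) (auto simp: bump_bounds)
  then show "(\<integral>x. bmp n x \<partial>\<nu>) \<le> 1" by (simp add: prob_space)
qed

lemma energy_term_bounds:
  assumes "prob_space \<nu>" "sets \<nu> = sets lipM"
  shows "0 \<le> (1/2) ^ n * (\<integral>x. bmp n x \<partial>\<nu>)\<^sup>2" "(1/2) ^ n * (\<integral>x. bmp n x \<partial>\<nu>)\<^sup>2 \<le> (1/2) ^ n"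
  using bmp_integral_bounds[OF assms, of n] by (auto intro!: mult_left_le power_le_one)

lemma energy_summable:
  assumes "prob_space \<nu>" "sets \<nu> = sets lipM"
  shows "summable (\<lambda>n. (1/2) ^ n * (\<integral>x. bmp n x \<partial>\<nu>)\<^sup>2)"
  by (rule summable_comparison_test'[OF summable_geometric[of "1/2::real"], of 0])
     (use energy_term_bounds[OF assms] in auto)

lemma energy_sums:
  assumes "prob_space \<nu>" "sets \<nu> = sets lipM"
  shows "(\<lambda>n. (1/2) ^ n * (\<integral>x. bmp n x \<partial>\<nu>)\<^sup>2) sums energy \<nu>"
  unfolding energy_def by (rule summable_sums[OF energy_summable[OF assms]])

lemma energy_le: assumes "prob_space \<nu>" "sets \<nu> = sets lipM" shows "energy \<nu> \<le> 2"
proof -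
  have "energy \<nu> \<le> (\<Sum>n. (1/2) ^ n)"
    unfolding energy_def by (intro suminf_le energy_summable assms energy_term_bounds summable_geometric) auto
  then show ?thesis by (simp add: suminf_geometric)
qed

lemma energy_tendsto:
  assumes \<mu>: "\<And>n. prob_space (\<mu> n)" "\<And>n. sets (\<mu> n) = sets lipM"
    and lim: "\<And>g. pcont g \<Longrightarrow> (\<lambda>n. \<integral>x. g x \<partial>\<mu> n) \<longlonglongrightarrow> (\<integral>x. g x \<partial>\<nu>)"
  shows "(\<lambda>n. energy (\<mu> n)) \<longlonglongrightarrow> energy \<nu>"
  unfolding energy_def
proof (rule tannerys_theorem[where M="\<lambda>j. (1/2) ^ j", THEN conjunct2, THEN conjunct2])
  show "(\<lambda>n. (1/2) ^ k * (\<integral>x. bmp k x \<partial>\<mu> n)\<^sup>2) \<longlonglongrightarrow> (1/2) ^ k * (\<integral>x. bmp k x \<partial>\<nu>)\<^sup>2" for k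
    by (intro tendsto_intros lim bmp_pcont)
  show "\<forall>\<^sub>F (k, n) in at_top \<times>\<^sub>F sequentially. norm ((1/2) ^ k * (\<integral>x. bmp k x \<partial>\<mu> n)\<^sup>2) \<le> (1/2) ^ k"
    using energy_term_bounds[OF \<mu>] by (auto intro!: always_eventually)
qed auto

text \<open>The assumption \<open>cl\<close> bundles sequential compactness of \<open>S\<close> with
  upper semicontinuity: it asks only for a point of \<open>S\<close> that does at least as well as
  the limiting value.\<close>

lemma attains_max:
  fixes \<Psi> :: "'a \<Rightarrow> real"
  assumes ne: "S \<noteq> {}" and bd: "\<And>x. x \<in> S \<Longrightarrow> \<Psi> x \<le> C"
    and cl: "\<And>y a. (\<And>n::nat. y n \<in> S) \<Longrightarrow> (\<lambda>n. \<Psi> (y n)) \<longlonglongrightarrow> a \<Longrightarrow> \<exists>x\<in>S. a \<le> \<Psi> x"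
  obtains x where "x \<in> S" "\<And>y. y \<in> S \<Longrightarrow> \<Psi> y \<le> \<Psi> x"
proof -
  have bdd: "bdd_above (\<Psi> ` S)" using bd by (auto intro!: bdd_aboveI[of _ C])
  define a where "a = Sup (\<Psi> ` S)"
  have "\<forall>n. \<exists>x\<in>S. a - 1 / real (Suc n) < \<Psi> x"
  proof
    fix n
    have "a - 1 / real (Suc n) < Sup (\<Psi> ` S)" unfolding a_def by simp
    then show "\<exists>x\<in>S. a - 1 / real (Suc n) < \<Psi> x"
      using less_cSup_iff[of "\<Psi> ` S"] ne bdd by auto
  qed
  then obtain y where y: "\<And>n. y n \<in> S" "\<And>n. a - 1 / real (Suc n) < \<Psi> (y n)" by metis
  have up: "\<Psi> x \<le> a" if "x \<in> S" for x unfolding a_def using that bdd by (auto intro: cSup_upper)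
  have "(\<lambda>n. \<Psi> (y n)) \<longlonglongrightarrow> a"
  proof (rule tendsto_sandwich[of "\<lambda>n. a - 1 / real (Suc n)" _ _ "\<lambda>_. a"])
    have "(\<lambda>n. a - 1 / real (Suc n)) \<longlonglongrightarrow> a - 0"
      by (intro tendsto_intros LIMSEQ_Suc[OF lim_1_over_n])
    then show "(\<lambda>n. a - 1 / real (Suc n)) \<longlonglongrightarrow> a" by simp
  qed (use y up in \<open>auto intro!: always_eventually less_imp_le\<close>)
  then obtain x where "x \<in> S" "a \<le> \<Psi> x" using cl[of y a] y by blast
  then show ?thesis using up by (intro that[of x]) (auto intro: order.trans)
qed

lemma hull_compact:
  assumes "\<And>n. \<nu> n \<in> hull_measures f"
  shows "\<exists>r \<kappa>. strict_mono (r :: nat \<Rightarrow> nat) \<and> \<kappa> \<in> hull_measures f \<and>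
    (\<forall>g. pcont g \<longrightarrow> (\<lambda>n. \<integral>x. g x \<partial>\<nu> (r n)) \<longlonglongrightarrow> (\<integral>x. g x \<partial>\<kappa>))"
proof -
  note D = hull_measuresD[OF assms]
  obtain r \<kappa> where r: "strict_mono (r :: nat \<Rightarrow> nat)" "prob_space \<kappa>" "sets \<kappa> = sets lipM"
    and lim: "\<And>g. pcont g \<Longrightarrow> (\<lambda>n. \<integral>x. g x \<partial>\<nu> (r n)) \<longlonglongrightarrow> (\<integral>x. g x \<partial>\<kappa>)"
    using weak_compactness[of \<nu>, OF D(1,2)] by auto
  have "\<kappa> \<in> hull_measures f"
  proof (rule limit_in_hull_measures[OF r(2,3) lim])
    fix g t assume g: "pcont g"
    have "(\<integral>x. g (shift_fun t x) \<partial>\<nu> n) = (\<integral>x. g x \<partial>\<nu> n)" for n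
    proof -
      note [measurable_cong] = D(2)
      note [measurable] = pcont_measurable[OF g]
      have "(\<integral>x. g x \<partial>\<nu> n) = (\<integral>x. g x \<partial>distr (\<nu> n) lipM (shift_fun t))" by (simp add: D(3))
      also have "\<dots> = (\<integral>x. g (shift_fun t x) \<partial>\<nu> n)" by (subst integral_distr) auto
      finally show ?thesis by simp
    qed
    then show "(\<lambda>n. (\<integral>x. g (shift_fun t x) \<partial>\<nu> (r n)) - (\<integral>x. g x \<partial>\<nu> (r n))) \<longlonglongrightarrow> 0" by simp
  qed (use D(5) in auto)
  then show ?thesis using r lim by blast
qed

text \<open>The second maximisation singles out an extreme point, because \<^const>\<open>energy\<close> is strictly convex.\<close>

lemma maximal_measure:
  assumes "\<nu>0 \<in> hull_measures f"
  obtains \<nu> where "\<nu> \<in> hull_measures f" "measure \<nu>0 peak \<le> measure \<nu> peak"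
    "\<And>\<kappa>. \<kappa> \<in> hull_measures f \<Longrightarrow> measure \<kappa> peak \<le> measure \<nu> peak"
    "\<And>\<kappa>. \<kappa> \<in> hull_measures f \<Longrightarrow> measure \<nu> peak \<le> measure \<kappa> peak \<Longrightarrow> energy \<kappa> \<le> energy \<nu>"
proof -
  obtain \<nu>1 where \<nu>1: "\<nu>1 \<in> hull_measures f" "\<And>\<kappa>. \<kappa> \<in> hull_measures f \<Longrightarrow> measure \<kappa> peak \<le> measure \<nu>1 peak"
  proof (rule attains_max[where S="hull_measures f" and \<Psi>="\<lambda>\<nu>. measure \<nu> peak" and C=1])
    fix y a assume y: "\<And>n::nat. y n \<in> hull_measures f" and a: "(\<lambda>n. measure (y n) peak) \<longlonglongrightarrow> a"
    obtain r \<kappa> where r: "strict_mono (r :: nat \<Rightarrow> nat)" "\<kappa> \<in> hull_measures f"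
      "\<And>g. pcont g \<Longrightarrow> (\<lambda>n. \<integral>x. g x \<partial>y (r n)) \<longlonglongrightarrow> (\<integral>x. g x \<partial>\<kappa>)"
      using hull_compact[of y, OF y] by auto
    have "a \<le> measure \<kappa> peak"
      by (rule peak_upper_semicontinuous[OF hull_measuresD(1,2)[OF r(2)] hull_measuresD(1,2)[OF y] r(3) LIMSEQ_subseq_LIMSEQ[OF a r(1)]])
         (auto simp: o_def)
    then show "\<exists>x\<in>hull_measures f. a \<le> measure x peak" using r(2) by blast
  next
    show "measure \<kappa> peak \<le> 1" if "\<kappa> \<in> hull_measures f" for \<kappa>
      using prob_space.prob_le_1[OF hull_measuresD(1)[OF that]] .
  qed (use assms in auto)
  \<comment> \<open>The set of all maximisers of the first functional. Written as a superlevel set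
    it is closed under weak limits, by upper semicontinuity.\<close>
  define S where "S = {\<nu> \<in> hull_measures f. measure \<nu>1 peak \<le> measure \<nu> peak}"
  obtain \<nu>2 where \<nu>2: "\<nu>2 \<in> S" "\<And>\<kappa>. \<kappa> \<in> S \<Longrightarrow> energy \<kappa> \<le> energy \<nu>2"
  proof (rule attains_max[where S=S and \<Psi>=energy and C=2])
    fix y a assume y: "\<And>n::nat. y n \<in> S" and a: "(\<lambda>n. energy (y n)) \<longlonglongrightarrow> a"
    have yh: "y n \<in> hull_measures f" for n using y[of n] by (simp add: S_def)
    obtain r \<kappa> where r: "strict_mono (r :: nat \<Rightarrow> nat)" "\<kappa> \<in> hull_measures f"
      "\<And>g. pcont g \<Longrightarrow> (\<lambda>n. \<integral>x. g x \<partial>y (r n)) \<longlonglongrightarrow> (\<integral>x. g x \<partial>\<kappa>)"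
      using hull_compact[of y, OF yh] by auto
    have "measure \<nu>1 peak \<le> measure \<kappa> peak"
      by (rule peak_upper_semicontinuous[OF hull_measuresD(1,2)[OF r(2)] hull_measuresD(1,2)[OF yh] r(3) tendsto_const])
         (use y in \<open>auto simp: S_def\<close>)
    moreover have "energy \<kappa> = a"
      by (rule LIMSEQ_unique[OF energy_tendsto[OF hull_measuresD(1,2)[OF yh] r(3)]])
         (use LIMSEQ_subseq_LIMSEQ[OF a r(1)] in \<open>auto simp: o_def\<close>)
    ultimately show "\<exists>x\<in>S. a \<le> energy x" using r(2) by (auto simp: S_def)
  next
    show "energy \<kappa> \<le> 2" if "\<kappa> \<in> S" for \<kappa>
      using that hull_measuresD(1,2) energy_le by (auto simp: S_def)
  qed (use \<nu>1 in \<open>auto simp: S_def\<close>)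
  have eq: "measure \<nu>2 peak = measure \<nu>1 peak" using \<nu>2 \<nu>1 by (auto simp: S_def intro: antisym)
  show ?thesis
    by (rule that[of \<nu>2]) (use \<nu>1 \<nu>2 eq assms in \<open>auto simp: S_def\<close>)
qed

section \<open>Ergodicity of maximal measures\<close>

lemma integral_uniform_measure:
  fixes g :: "'a \<Rightarrow> real"
  assumes A [measurable]: "A \<in> sets M" and a: "emeasure M A \<noteq> 0" "emeasure M A \<noteq> \<infinity>"
    and g [measurable]: "g \<in> borel_measurable M"
  shows "(\<integral>x. g x \<partial>uniform_measure M A) = (\<integral>x. indicator A x * g x \<partial>M) / measure M A"
proof -
  have e: "emeasure M A = ennreal (measure M A)"
    using a(2) by (intro emeasure_eq_ennreal_measure) simp
  have a0: "measure M A > 0" using a by (simp add: e less_le)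
  have "uniform_measure M A = density M (\<lambda>x. ennreal (indicator A x / measure M A))"
    unfolding uniform_measure_def using a0
    by (intro arg_cong[of _ _ "density M"] ext)
       (auto simp: e divide_ennreal ennreal_indicator[symmetric] simp del: ennreal_indicator)
  then have "(\<integral>x. g x \<partial>uniform_measure M A) = (\<integral>x. (indicator A x / measure M A) *\<^sub>R g x \<partial>M)"
    by (simp add: integral_density)
  also have "\<dots> = (\<integral>x. indicator A x * g x / measure M A \<partial>M)"
    by (intro Bochner_Integration.integral_cong) auto
  finally show ?thesis by simp
qed

lemma completion_shift_fun:
  assumes \<nu>: "\<nu> \<in> hull_measures f"
  shows "shift_fun t \<in> completion \<nu> \<rightarrow>\<^sub>M completion \<nu>"
    and "B \<in> sets (completion \<nu>) \<Longrightarrow> emeasure (completion \<nu>) (shift_fun t -` B \<inter> lip) = emeasure (completion \<nu>) B"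
proof -
  note D = hull_measuresD[OF \<nu>]
  note [measurable_cong] = D(2)
  have m: "shift_fun t \<in> \<nu> \<rightarrow>\<^sub>M \<nu>" by measurable
  have inv: "distr \<nu> \<nu> (shift_fun t) = \<nu>"
    using D(3)[of t] distr_cong[of \<nu> \<nu> \<nu> lipM "shift_fun t" "shift_fun t"] D(2) by simp
  then have d: "distr (completion \<nu>) \<nu> (shift_fun t) = \<nu>"
    using distr_completion[OF m] by simp
  have m': "shift_fun t \<in> completion \<nu> \<rightarrow>\<^sub>M \<nu>" by (rule measurable_completion[OF m])
  show m'': "shift_fun t \<in> completion \<nu> \<rightarrow>\<^sub>M completion \<nu>"
    by (rule completion.measurable_completion2[OF m']) (simp add: d)
  have "distr (completion \<nu>) (completion \<nu>) (shift_fun t) = completion \<nu>"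
    using completion.completion_distr_eq[OF m'] d by simp
  then show "emeasure (completion \<nu>) (shift_fun t -` B \<inter> lip) = emeasure (completion \<nu>) B" if "B \<in> sets (completion \<nu>)"
    using emeasure_distr[OF m'' that] by (simp add: D(4))
qed

lemma shift_fun_flow:
  assumes \<nu>: "\<nu> \<in> hull_measures f"
  shows "measure_preserving_flow (completion \<nu>) shift_fun"
proof -
  note D = hull_measuresD[OF \<nu>]
  note [measurable_cong] = D(2)
  interpret prob_space \<nu> by (rule D)
  have "Lebesgue_prob_space (completion \<nu>)"
  proof (rule Lebesgue_prob_space_completion[of _ code])
    show "inj_on code (space \<nu>)" by (rule inj_on_inverseI[of _ decode]) (simp add: D decode_code)
    fix A assume "A \<in> sets \<nu>"
    then have [measurable]: "A \<in> sets lipM" by (simp add: D)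
    then have "A \<subseteq> lip" using sets.sets_into_space[of A lipM] by simp
    \<comment> \<open>The same device as in \<open>code_image\<close>: the image is rewritten as a
      preimage under \<open>decode\<close> intersected with a set of fixed points.\<close>
    then have "code ` A = {y. code (decode y) = y \<and> decode y \<in> A}"
      using decode_code by (auto simp: subset_iff intro: image_eqI[of _ code, OF sym])
    also have "\<dots> \<in> sets borel" by measurable
    finally show "code ` A \<in> sets borel" .
  qed (auto simp: D)
  moreover have "invertible_measure_preserving (completion \<nu>) (shift_fun t)" for t
    unfolding invertible_measure_preserving_def
  proof (intro conjI ballI)
    show "inv_into (space (completion \<nu>)) (shift_fun t) \<in> completion \<nu> \<rightarrow>\<^sub>M completion \<nu>"
    proof (subst measurable_cong)
      fix x assume "x \<in> space (completion \<nu>)"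
      then have x: "x \<in> lip" by (simp add: D)
      show "inv_into (space (completion \<nu>)) (shift_fun t) x = shift_fun (-t) x"
        using inv_into_f_f[of "shift_fun t" lip "shift_fun (-t) x"] shift_fun_bij[of t] x
        by (simp add: D bij_betw_def shift_fun_lip shift_fun_shift_fun)
    qed (rule completion_shift_fun[OF \<nu>])
  qed (use completion_shift_fun[OF \<nu>] shift_fun_bij in \<open>simp_all add: D\<close>)
  moreover have "(\<lambda>(t, x). shift_fun t x) \<in> completion (lborel \<Otimes>\<^sub>M completion \<nu>) \<rightarrow>\<^sub>M completion \<nu>"
  proof (rule completion.measurable_completion2)
    have i: "(\<lambda>x. x) \<in> completion \<nu> \<rightarrow>\<^sub>M \<nu>" by (rule measurable_completion) simp
    have "(\<lambda>p. p) \<in> lborel \<Otimes>\<^sub>M completion \<nu> \<rightarrow>\<^sub>M borel \<Otimes>\<^sub>M \<nu>"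
      by (rule measurable_pair) (use measurable_compose[OF measurable_snd i] in \<open>auto simp: o_def\<close>)
    moreover have j: "(\<lambda>(t, x). shift_fun t x) \<in> borel \<Otimes>\<^sub>M \<nu> \<rightarrow>\<^sub>M \<nu>"
      using shift_fun_joint_measurable by measurable
    ultimately have m: "(\<lambda>(t, x). shift_fun t x) \<in> lborel \<Otimes>\<^sub>M completion \<nu> \<rightarrow>\<^sub>M \<nu>"
      by (rule measurable_compose)
    then show m': "(\<lambda>(t, x). shift_fun t x) \<in> completion (lborel \<Otimes>\<^sub>M completion \<nu>) \<rightarrow>\<^sub>M \<nu>"
      by (rule measurable_completion)
    \<comment> \<open>Measurability into the completion requires that preimages of null sets be
      null. Every time section of such a preimage is null by invariance, so Fubini applies.\<close>
    show "null_sets \<nu> \<subseteq> null_sets (distr (completion (lborel \<Otimes>\<^sub>M completion \<nu>)) \<nu> (\<lambda>(t, x). shift_fun t x))"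
    proof
      fix C assume C: "C \<in> null_sets \<nu>"
      interpret c: prob_space "completion \<nu>" by (rule prob_space_completion)
      define S where "S = (\<lambda>(t, x). shift_fun t x) -` C \<inter> space (lborel \<Otimes>\<^sub>M completion \<nu>)"
      have S: "S \<in> sets (lborel \<Otimes>\<^sub>M completion \<nu>)"
        unfolding S_def using C by (intro measurable_sets[OF m]) auto
      have "emeasure (lborel \<Otimes>\<^sub>M completion \<nu>) S = (\<integral>\<^sup>+t. emeasure (completion \<nu>) (Pair t -` S) \<partial>lborel)"
        by (rule c.emeasure_pair_measure_alt[OF S])
      also have "\<dots> = (\<integral>\<^sup>+t. 0 \<partial>(lborel :: real measure))"
      proof (rule nn_integral_cong)
        fix t :: real
        have "Pair t -` S = shift_fun t -` C \<inter> lip"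
          by (auto simp: S_def space_pair_measure D)
        then show "emeasure (completion \<nu>) (Pair t -` S) = 0"
          using null_setsD1[OF C] null_setsD2[OF C] by (simp add: completion_shift_fun(2)[OF \<nu>])
      qed
      also have "\<dots> = 0" by simp
      finally show "C \<in> null_sets (distr (completion (lborel \<Otimes>\<^sub>M completion \<nu>)) \<nu> (\<lambda>(t, x). shift_fun t x))"
        using C S m' by (intro null_setsI) (auto simp: emeasure_distr S_def[symmetric])
    qed
  qed
  ultimately show ?thesis
    by (auto simp: measure_preserving_flow_def shift_fun_shift_fun)
qed

text \<open>An invariant set \<open>A'\<close> is exactly invariant but measurable only for the
  completion, while conditioning on \<nu> calls for its measurable version \<open>A\<close>. Masses
  are moved to \<open>A'\<close> where invariance is used. The orbit closure clause passes on
  because a nonnegative function with integral 0 vanishes almost everywhere.\<close>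

lemma uniform_measure_in_hull:
  assumes \<nu>: "\<nu> \<in> hull_measures f" and A: "A \<in> sets \<nu>" "measure \<nu> A \<noteq> 0"
    and A': "A' \<in> sets (completion \<nu>)" and inv: "\<And>t. shift_fun t -` A' \<inter> lip = A'"
    and ae: "AE x in completion \<nu>. x \<in> A \<longleftrightarrow> x \<in> A'"
  shows "uniform_measure \<nu> A \<in> hull_measures f"
proof -
  note D = hull_measuresD[OF \<nu>]
  note [measurable_cong] = D(2)
  interpret prob_space \<nu> by (rule D)
  have eA: "emeasure \<nu> A \<noteq> 0" "emeasure \<nu> A \<noteq> \<infinity>" using A by (auto simp: emeasure_eq_measure)
  have AC: "emeasure \<nu> (A \<inter> C) = emeasure (completion \<nu>) (A' \<inter> C)" if C: "C \<in> sets \<nu>" for C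
  proof -
    have "emeasure \<nu> (A \<inter> C) = emeasure (completion \<nu>) (A \<inter> C)" using A C by simp
    also have "\<dots> = emeasure (completion \<nu>) (A' \<inter> C)"
    proof (rule emeasure_eq_AE)
      show "AE x in completion \<nu>. x \<in> A \<inter> C \<longleftrightarrow> x \<in> A' \<inter> C" using ae by eventually_elim auto
    qed (use A A' C in auto)
    finally show ?thesis .
  qed
  have "distr (uniform_measure \<nu> A) lipM (shift_fun t) = uniform_measure \<nu> A" for t
  proof (rule measure_eqI)
    fix B assume "B \<in> sets (distr (uniform_measure \<nu> A) lipM (shift_fun t))"
    then have B: "B \<in> sets \<nu>" "B \<in> sets lipM" by (auto simp: D)
    have B': "shift_fun t -` B \<inter> lip \<in> sets \<nu>"
      using measurable_sets[OF shift_fun_measurable B(2), of t] by (simp add: D)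
    have "emeasure (distr (uniform_measure \<nu> A) lipM (shift_fun t)) B = emeasure (uniform_measure \<nu> A) (shift_fun t -` B \<inter> lip)"
      using B by (subst emeasure_distr) (auto simp: D)
    also have "\<dots> = emeasure (completion \<nu>) (A' \<inter> (shift_fun t -` B \<inter> lip)) / emeasure \<nu> A"
      using A B' by (simp add: AC)
    also have "A' \<inter> (shift_fun t -` B \<inter> lip) = shift_fun t -` (A' \<inter> B) \<inter> lip" using inv[of t] by auto
    also have "emeasure (completion \<nu>) (shift_fun t -` (A' \<inter> B) \<inter> lip) = emeasure (completion \<nu>) (A' \<inter> B)"
      using A' B by (intro completion_shift_fun[OF \<nu>]) auto
    also have "\<dots> / emeasure \<nu> A = emeasure (uniform_measure \<nu> A) B" using A B by (simp add: AC)
    finally show "emeasure (distr (uniform_measure \<nu> A) lipM (shift_fun t)) B = emeasure (uniform_measure \<nu> A) B" .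
  qed (simp add: D)
  moreover have "(\<integral>x. g x \<partial>uniform_measure \<nu> A) = 0"
    if g: "pcont g" "\<And>x. x \<in> lip \<Longrightarrow> 0 \<le> g x" "\<And>s. g (shift_fun s f) = 0" for g
  proof -
    have "AE x in \<nu>. 0 \<le> g x" using g(2) by (intro AE_I2) (simp add: D)
    then have "AE x in \<nu>. g x = 0"
      using D(5)[OF g] integral_nonneg_eq_0_iff_AE[OF pcont_integrable[OF D(1,2) g(1)]] by simp
    then have "AE x in uniform_measure \<nu> A. g x = 0" by (intro AE_uniform_measureI A) auto
    then show ?thesis by (rule integral_eq_zero_AE)
  qed
  moreover have "prob_space (uniform_measure \<nu> A)" by (rule prob_space_uniform_measure[OF eA])
  ultimately show ?thesis using D(2) by (auto simp: hull_measures_def)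
qed

text \<open>If \<open>A\<close> were invariant of measure \<open>a\<close> strictly between \<open>0\<close> and \<open>1\<close>, then \<open>\<nu>\<close> would be a proper convex
  combination of its conditional measures on \<open>A\<close> and on the complement; these are maximisers of
  \<open>peak\<close> as well, so strict convexity of \<^const>\<open>energy\<close> forces them to coincide.\<close>

lemma maximal_ergodic:
  assumes \<nu>: "\<nu> \<in> hull_measures f"
    and peak: "\<And>\<kappa>. \<kappa> \<in> hull_measures f \<Longrightarrow> measure \<kappa> peak \<le> measure \<nu> peak"
    and energy: "\<And>\<kappa>. \<kappa> \<in> hull_measures f \<Longrightarrow> measure \<nu> peak \<le> measure \<kappa> peak \<Longrightarrow> energy \<kappa> \<le> energy \<nu>"
  shows "ergodic_flow (completion \<nu>) shift_fun"
  unfolding ergodic_flow_def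
proof (intro conjI shift_fun_flow[OF \<nu>] ballI impI, rule ccontr)
  note D = hull_measuresD[OF \<nu>]
  note [measurable_cong] = D(2)
  interpret prob_space \<nu> by (rule D)
  fix A' assume A': "A' \<in> sets (completion \<nu>)" and img: "\<forall>t. shift_fun t ` A' = A'"
    and "\<not> (measure (completion \<nu>) A' = 0 \<or> measure (completion \<nu>) A' = 1)"
  define A where "A = main_part \<nu> A'"
  define a where "a = measure \<nu> A"
  have A [measurable]: "A \<in> sets \<nu>" unfolding A_def using A' by simp
  have "measure (completion \<nu>) A' = a" unfolding a_def A_def measure_def using A' by simp
  then have a: "a \<noteq> 0" "a \<noteq> 1" using \<open>\<not> _\<close> by auto
  have A'lip: "A' \<subseteq> lip" using sets.sets_into_space[OF A'] by (simp add: D)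
  have inv: "shift_fun t -` A' \<inter> lip = A'" for t
  proof safe
    fix x assume "shift_fun t x \<in> A'"
    then have "shift_fun (-t) (shift_fun t x) \<in> A'" using img by blast
    then show "x \<in> A'" by (simp add: shift_fun_shift_fun)
  qed (use img A'lip in auto)
  have ae: "AE x in completion \<nu>. x \<in> A \<longleftrightarrow> x \<in> A'"
    using AE_completion[OF AE_notin_null_part[OF A']] main_part_null_part_Un[OF A']
    by (auto simp: A_def elim!: eventually_mono)
  define B where "B = lip - A"
  have B [measurable]: "B \<in> sets \<nu>" using sets.compl_sets[OF A] by (simp add: B_def D)
  have mB: "measure \<nu> B = 1 - a" using prob_compl[OF A] by (simp add: B_def a_def D)
  have K1: "uniform_measure \<nu> A \<in> hull_measures f"
    using a by (intro uniform_measure_in_hull[OF \<nu> A _ A' inv ae]) (simp add: a_def)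
  have K2: "uniform_measure \<nu> B \<in> hull_measures f"
  proof (rule uniform_measure_in_hull[OF \<nu> B])
    show "lip - A' \<in> sets (completion \<nu>)" using sets.compl_sets[OF A'] by (simp add: D)
    show "shift_fun t -` (lip - A') \<inter> lip = lip - A'" for t
      using inv[of t] shift_fun_lip by auto
    have "AE x in completion \<nu>. x \<in> lip" by (rule AE_I2) (simp add: D)
    with ae show "AE x in completion \<nu>. x \<in> B \<longleftrightarrow> x \<in> lip - A'"
      by eventually_elim (auto simp: B_def)
  qed (use mB a in simp)
  note D1 = hull_measuresD[OF K1] and D2 = hull_measuresD[OF K2]
  have a01: "0 < a" "a < 1" using a prob_le_1[of A] by (auto simp: a_def less_le)
  have split: "(\<integral>x. g x \<partial>\<nu>) = a * (\<integral>x. g x \<partial>uniform_measure \<nu> A) + (1 - a) * (\<integral>x. g x \<partial>uniform_measure \<nu> B)"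
    if g: "integrable \<nu> g" for g :: "_ \<Rightarrow> real"
  proof -
    have [measurable]: "g \<in> borel_measurable \<nu>" using g by simp
    have "(\<integral>x. g x \<partial>\<nu>) = (\<integral>x. indicator A x * g x + indicator B x * g x \<partial>\<nu>)"
      by (intro Bochner_Integration.integral_cong) (auto simp: D B_def indicator_def)
    also have "\<dots> = (\<integral>x. indicator A x * g x \<partial>\<nu>) + (\<integral>x. indicator B x * g x \<partial>\<nu>)"
      using integrable_real_mult_indicator[OF A g] integrable_real_mult_indicator[OF B g]
      by (intro Bochner_Integration.integral_add) (simp_all only: mult.commute)
    also have "(\<integral>x. indicator A x * g x \<partial>\<nu>) = a * (\<integral>x. g x \<partial>uniform_measure \<nu> A)"
      using a01 integral_uniform_measure[OF A, of g] by (simp add: emeasure_eq_measure flip: a_def)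
    also have "(\<integral>x. indicator B x * g x \<partial>\<nu>) = (1 - a) * (\<integral>x. g x \<partial>uniform_measure \<nu> B)"
      using a01 integral_uniform_measure[OF B, of g] by (simp add: emeasure_eq_measure mB)
    finally show ?thesis .
  qed
  have [measurable]: "peak \<in> sets \<nu>" by (simp add: D)
  have pk: "measure \<nu> peak = a * measure (uniform_measure \<nu> A) peak + (1 - a) * measure (uniform_measure \<nu> B) peak"
    using split[of "indicator peak"] by (simp add: emeasure_eq_measure)
  have "measure \<nu> peak \<le> measure (uniform_measure \<nu> A) peak"
  proof (rule ccontr)
    assume "\<not> ?thesis"
    then have "a * measure (uniform_measure \<nu> A) peak < a * measure \<nu> peak" using a01 by simp
    moreover have "(1 - a) * measure (uniform_measure \<nu> B) peak \<le> (1 - a) * measure \<nu> peak"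
      using a01 peak[OF K2] by (intro mult_left_mono) auto
    ultimately show False using pk by (simp add: algebra_simps)
  qed
  then have g1: "energy (uniform_measure \<nu> A) \<le> energy \<nu>" by (rule energy[OF K1])
  have "measure \<nu> peak \<le> measure (uniform_measure \<nu> B) peak"
  proof (rule ccontr)
    assume "\<not> ?thesis"
    then have "(1 - a) * measure (uniform_measure \<nu> B) peak < (1 - a) * measure \<nu> peak" using a01 by simp
    moreover have "a * measure (uniform_measure \<nu> A) peak \<le> a * measure \<nu> peak"
      using a01 peak[OF K1] by (intro mult_left_mono) auto
    ultimately show False using pk by (simp add: algebra_simps)
  qed
  then have g2: "energy (uniform_measure \<nu> B) \<le> energy \<nu>" by (rule energy[OF K2])
  define p where "p n = (\<integral>x. bmp n x \<partial>uniform_measure \<nu> A)" for n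
  define q where "q n = (\<integral>x. bmp n x \<partial>uniform_measure \<nu> B)" for n
  \<comment> \<open>The convexity defect of the \<open>n\<close>-th term. With weights
    \<open>a\<close> and \<open>1 - a\<close>, the mean of the squares exceeds the square of the
    mean by \<open>a * (1 - a) * (p n - q n)\<^sup>2\<close>; maximality forces the sum of these
    nonnegative defects to be at most 0.\<close>
  define d where "d n = a * ((1/2) ^ n * (p n)\<^sup>2) + (1 - a) * ((1/2) ^ n * (q n)\<^sup>2) - (1/2) ^ n * (\<integral>x. bmp n x \<partial>\<nu>)\<^sup>2" for n
  have d_eq: "d n = a * (1 - a) * (1/2) ^ n * (p n - q n)\<^sup>2" for n
    unfolding d_def split[OF pcont_integrable[OF D(1,2) bmp_pcont]] p_def[symmetric] q_def[symmetric]
    by (simp add: power2_eq_square algebra_simps)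
  have "(\<lambda>n. d n) sums (a * energy (uniform_measure \<nu> A) + (1 - a) * energy (uniform_measure \<nu> B) - energy \<nu>)"
    unfolding d_def gauge_def p_def q_def
    by (intro sums_diff sums_add sums_mult energy_sums D D1 D2)
  moreover have "a * energy (uniform_measure \<nu> A) + (1 - a) * energy (uniform_measure \<nu> B) - energy \<nu> \<le> 0"
  proof -
    have "a * energy (uniform_measure \<nu> A) + (1 - a) * energy (uniform_measure \<nu> B) \<le> a * energy \<nu> + (1 - a) * energy \<nu>"
      using a01 g1 g2 by (intro add_mono mult_left_mono) auto
    also have "\<dots> = energy \<nu>" by (simp add: algebra_simps)
    finally show ?thesis by simp
  qed
  moreover have d0: "0 \<le> d n" for n using a01 by (simp add: d_eq)
  ultimately have "suminf d \<le> 0" "summable d" by (auto simp: sums_iff)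
  then have "d n = 0" for n
    using suminf_eq_zero_iff[of d] d0 suminf_nonneg[of d] by auto
  then have pq: "p n = q n" for n using a01 by (simp add: d_eq)
  have "uniform_measure \<nu> A = uniform_measure \<nu> B"
  proof (rule measure_eqI_bump[OF D1(1,2) D2(1,2)])
    fix F :: "(rat \<times> rat) set" and j assume "finite F"
    then obtain l where "set l = F" using finite_list by blast
    then show "(\<integral>x. bump (F, j) x \<partial>uniform_measure \<nu> A) = (\<integral>x. bump (F, j) x \<partial>uniform_measure \<nu> B)"
      using pq[of "to_nat (l, j)"] by (simp add: p_def q_def)
  qed
  then have "measure (uniform_measure \<nu> A) A = measure (uniform_measure \<nu> B) A" by simp
  moreover have "measure (uniform_measure \<nu> A) A = 1"
    using a by (subst measure_uniform_measure) (auto simp: a_def emeasure_eq_measure)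
  moreover have "measure (uniform_measure \<nu> B) A = 0"
  proof -
    have "B \<inter> A = {}" by (auto simp: B_def)
    then show ?thesis using a01 mB by (subst measure_uniform_measure) (auto simp: emeasure_eq_measure)
  qed
  ultimately show False by simp
qed

section \<open>Densities and averages\<close>

lemma upper_Banach_density_gt:
  assumes "ereal c < upper_Banach_density E"
  shows "\<exists>M N. L \<le> N - M \<and> c < measure lebesgue (E \<inter> {M..N}) / (N - M)"
proof (rule ccontr)
  assume "\<not> ?thesis"
  then have *: "L \<le> N - M \<Longrightarrow> measure lebesgue (E \<inter> {M..N}) / (N - M) \<le> c" for M N
    by (metis not_le)
  have "\<forall>\<^sub>F p in filtercomap (\<lambda>(M, N). N - M) at_top.
      (\<lambda>(M, N). ereal (measure lebesgue (E \<inter> {M..N}) / (N - M))) p \<le> ereal c"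
    unfolding eventually_filtercomap using eventually_ge_at_top[of L]
    by (intro exI[of _ "\<lambda>x. L \<le> x"]) (auto simp: *)
  then have "upper_Banach_density E \<le> ereal c"
    unfolding upper_Banach_density_def by (rule Limsup_bounded)
  then show False using assms by simp
qed

lemma upper_Banach_density_ge:
  assumes "\<And>L e. L > 0 \<Longrightarrow> e > 0 \<Longrightarrow> \<exists>M. c - e \<le> measure lebesgue (W \<inter> {M..M + L}) / L"
  shows "ereal c \<le> upper_Banach_density W"
proof (rule ccontr)
  assume "\<not> ?thesis"
  then have "upper_Banach_density W < ereal c" by simp
  then obtain y where y: "upper_Banach_density W < ereal y" "ereal y < ereal c"
    using ereal_dense2 by blast
  have "\<forall>\<^sub>F p in filtercomap (\<lambda>(M, N). N - M) at_top.
      (\<lambda>(M, N). ereal (measure lebesgue (W \<inter> {M..N}) / (N - M))) p < ereal y"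
    by (rule Limsup_lessD) (use y in \<open>simp add: upper_Banach_density_def\<close>)
  then obtain L where L: "\<And>M N. L \<le> N - M \<Longrightarrow> measure lebesgue (W \<inter> {M..N}) / (N - M) < y"
    by (auto simp: eventually_filtercomap eventually_at_top_linorder)
  \<comment> \<open>The threshold \<open>L\<close> may be negative, hence \<open>max L 1\<close>;
    the slack \<open>c - y\<close> makes the lower bound equal to \<open>y\<close>.\<close>
  have "\<exists>M. c - (c - y) \<le> measure lebesgue (W \<inter> {M..M + max L 1}) / max L 1"
    using y by (intro assms) auto
  then obtain M where "c - (c - y) \<le> measure lebesgue (W \<inter> {M..M + max L 1}) / max L 1" by blast
  moreover have "measure lebesgue (W \<inter> {M..M + max L 1}) / (M + max L 1 - M) < y" by (rule L) simp
  ultimately show False by simp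
qed

lemma upper_Banach_density_finite:
  assumes "upper_Banach_density E > 0"
  obtains d where "upper_Banach_density E = ereal d" "d > 0"
proof -
  have "\<not> ereal 1 < upper_Banach_density E"
  proof
    assume "ereal 1 < upper_Banach_density E"
    then obtain M N where MN: "1 \<le> N - M" "1 < measure lebesgue (E \<inter> {M..N}) / (N - M)"
      using upper_Banach_density_gt by blast
    have "measure lebesgue (E \<inter> {M..N}) \<le> measure lebesgue {M..N}"
    proof (cases "E \<inter> {M..N} \<in> sets lebesgue")
      case True
      then show ?thesis by (intro measure_mono_fmeasurable) auto
    qed (simp add: measure_notin_sets)
    also have "\<dots> = N - M" using MN by simp
    finally show False using MN by (simp add: field_simps)
  qed
  then show ?thesis using assms that by (cases "upper_Banach_density E") auto
qed

section \<open>Empirical measures along an orbit and their limits\<close>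

lemma orbit_measurable: "f \<in> lip \<Longrightarrow> (\<lambda>t. shift_fun t f) \<in> borel \<rightarrow>\<^sub>M lipM"
proof (rule measurable_lipM)
  fix s assume "f \<in> lip"
  then have [measurable]: "f \<in> borel_measurable borel"
    by (intro borel_measurable_continuous_onI continuous_at_imp_continuous_on ballI lip_continuous)
  show "(\<lambda>t. shift_fun t f s) \<in> borel_measurable borel"
    unfolding shift_fun_def by measurable
qed (simp add: shift_fun_lip)

lemma orbit_measurable_uniform:
  "f \<in> lip \<Longrightarrow> (\<lambda>t. shift_fun t f) \<in> uniform_measure lborel A \<rightarrow>\<^sub>M lipM"
  using orbit_measurable by (simp add: measurable_cong_sets[OF sets_uniform_measure refl])

definition empirical :: "(real \<Rightarrow> real) \<Rightarrow> real \<Rightarrow> real \<Rightarrow> (real \<Rightarrow> real) measure" where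
  "empirical f M N = distr (uniform_measure lborel {M..N}) lipM (\<lambda>t. shift_fun t f)"

lemma empirical_prob:
  assumes "f \<in> lip" "M < N"
  shows "prob_space (empirical f M N)" "sets (empirical f M N) = sets lipM"
proof -
  note [measurable] = orbit_measurable_uniform[OF assms(1)]
  show "prob_space (empirical f M N)" unfolding empirical_def using assms(2)
    by (intro prob_space.prob_space_distr prob_space_uniform_measure) auto
qed (simp add: empirical_def)

lemma empirical_integral:
  assumes f: "f \<in> lip" and "M < N" and g: "g \<in> borel_measurable lipM"
  shows "(\<integral>x. g x \<partial>empirical f M N) = (\<integral>t. indicator {M..N} t * g (shift_fun t f) \<partial>lborel) / (N - M)"
proof -
  note [measurable] = orbit_measurable[OF f] orbit_measurable_uniform[OF f] g
  have "(\<integral>x. g x \<partial>empirical f M N) = (\<integral>t. g (shift_fun t f) \<partial>uniform_measure lborel {M..N})"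
    unfolding empirical_def by (subst integral_distr) auto
  also have "\<dots> = (\<integral>t. indicator {M..N} t * g (shift_fun t f) \<partial>lborel) / measure lborel {M..N}"
    using \<open>M < N\<close> by (intro integral_uniform_measure) auto
  finally show ?thesis using \<open>M < N\<close> by simp
qed

text \<open>Shifting by \<open>u\<close> translates the interval, and the two intervals differ only
  within distance \<bar>u\<bar> of the endpoints. Two windows of length 2\<bar>u\<bar>, on which the
  integrand is at most \<open>B\<close>, give the constant 4.\<close>

lemma empirical_shift_bound:
  assumes f: "f \<in> lip" and MN: "M < N" and g: "g \<in> borel_measurable lipM" and B: "\<And>x. x \<in> lip \<Longrightarrow> \<bar>g x\<bar> \<le> B"
  shows "\<bar>(\<integral>x. g (shift_fun u x) \<partial>empirical f M N) - (\<integral>x. g x \<partial>empirical f M N)\<bar> \<le> 4 * B * \<bar>u\<bar> / (N - M)"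
proof -
  note [measurable] = orbit_measurable[OF f] g
  define \<phi> where "\<phi> t = g (shift_fun t f)" for t
  have [measurable]: "\<phi> \<in> borel_measurable borel" 
    unfolding \<phi>_def by (rule measurable_compose[OF orbit_measurable[OF f] g])
  have \<phi>B: "\<bar>\<phi> t\<bar> \<le> B" for t unfolding \<phi>_def by (intro B shift_fun_lip f)
  have B0: "0 \<le> B" using \<phi>B[of 0] by linarith
  have int: "integrable lborel (\<lambda>t. indicator {a..b} t * \<phi> t)" for a b
  proof (rule Bochner_Integration.integrable_bound)
    show "integrable lborel (\<lambda>t. B * indicator {a..b} t)"
      by (intro integrable_mult_right integrable_real_indicator) (auto simp: emeasure_lborel_Icc_eq)
    show "AE t in lborel. norm (indicator {a..b} t * \<phi> t) \<le> norm (B * indicator {a..b} t)"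
      using \<phi>B B0 by (auto simp: indicator_def)
  qed simp
  have "(\<integral>x. g (shift_fun u x) \<partial>empirical f M N) = (\<integral>t. indicator {M..N} t * \<phi> (u + t) \<partial>lborel) / (N - M)"
    by (subst empirical_integral[OF f MN]) (auto simp: \<phi>_def shift_fun_shift_fun)
  also have "(\<integral>t. indicator {M..N} t * \<phi> (u + t) \<partial>lborel) = (\<integral>t. indicator {M + u..N + u} (u + 1 * t) * \<phi> (u + 1 * t) \<partial>lborel)"
    by (intro Bochner_Integration.integral_cong) (auto simp: indicator_def)
  also have "\<dots> = (\<integral>t. indicator {M + u..N + u} t * \<phi> t \<partial>lborel)"
    using lborel_integral_real_affine[of 1 "\<lambda>t. indicator {M + u..N + u} t * \<phi> t" u] by simp
  finally have 1: "(\<integral>x. g (shift_fun u x) \<partial>empirical f M N) = (\<integral>t. indicator {M + u..N + u} t * \<phi> t \<partial>lborel) / (N - M)" .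
  have 2: "(\<integral>x. g x \<partial>empirical f M N) = (\<integral>t. indicator {M..N} t * \<phi> t \<partial>lborel) / (N - M)"
    unfolding \<phi>_def by (rule empirical_integral[OF f MN g])
  let ?I = "\<lambda>c. indicator {c - \<bar>u\<bar>..c + \<bar>u\<bar>} :: real \<Rightarrow> real"
  have "\<bar>(\<integral>t. indicator {M + u..N + u} t * \<phi> t \<partial>lborel) - (\<integral>t. indicator {M..N} t * \<phi> t \<partial>lborel)\<bar> =
      \<bar>\<integral>t. indicator {M + u..N + u} t * \<phi> t - indicator {M..N} t * \<phi> t \<partial>lborel\<bar>"
    by (subst Bochner_Integration.integral_diff[OF int int]) simp
  also have "\<dots> \<le> (\<integral>t. B * ?I M t + B * ?I N t \<partial>lborel)"
  proof (rule integral_abs_bound_integral)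
    show "integrable lborel (\<lambda>t. B * ?I M t + B * ?I N t)" by (intro Bochner_Integration.integrable_add integrable_mult_right) auto
    show "\<bar>indicator {M + u..N + u} t * \<phi> t - indicator {M..N} t * \<phi> t\<bar> \<le> B * ?I M t + B * ?I N t" for t
      using \<phi>B[of t] B0 MN by (auto simp: indicator_def)
  qed (intro Bochner_Integration.integrable_diff int)
  also have "\<dots> = 4 * B * \<bar>u\<bar>"
    by (subst Bochner_Integration.integral_add) (auto simp: algebra_simps)
  finally show ?thesis unfolding 1 2 using MN
    by (simp add: divide_right_mono flip: diff_divide_distrib)
qed

text \<open>The times at which the orbit visits \<open>peak\<close> form a Borel set containing
  \<open>E\<close>, which itself is only Lebesgue measurable; this gives an inequality in the
  direction required.\<close>

lemma peak_empirical:
  assumes f: "f \<in> lip" and MN: "M < N" and E: "E \<in> sets lebesgue" and fE: "\<And>t. t \<in> E \<Longrightarrow> f t = 1"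
  shows "measure lebesgue (E \<inter> {M..N}) / (N - M) \<le> measure (empirical f M N) peak"
proof -
  note [measurable] = orbit_measurable[OF f] orbit_measurable_uniform[OF f]
  have S: "{t. shift_fun t f \<in> peak} \<in> sets borel" by measurable
  have "measure (empirical f M N) peak = measure (uniform_measure lborel {M..N}) {t. shift_fun t f \<in> peak}"
    unfolding empirical_def by (subst measure_distr) (auto simp: vimage_def)
  also have "\<dots> = measure lborel ({M..N} \<inter> {t. shift_fun t f \<in> peak}) / measure lborel {M..N}"
    using MN S by (intro measure_uniform_measure) auto
  also have "\<dots> = measure lebesgue ({M..N} \<inter> {t. shift_fun t f \<in> peak}) / (N - M)"
    using MN S by (subst measure_completion) auto
  finally have eq: "measure (empirical f M N) peak = measure lebesgue ({M..N} \<inter> {t. shift_fun t f \<in> peak}) / (N - M)" .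
  have "measure lebesgue (E \<inter> {M..N}) \<le> measure lebesgue ({M..N} \<inter> {t. shift_fun t f \<in> peak})"
  proof (rule measure_mono_fmeasurable)
    show "E \<inter> {M..N} \<subseteq> {M..N} \<inter> {t. shift_fun t f \<in> peak}"
      using fE f by (auto simp: peak_def shift_fun_lip) (simp add: shift_fun_def)
    show "{M..N} \<inter> {t. shift_fun t f \<in> peak} \<in> fmeasurable lebesgue"
      using S by (intro fmeasurable_Int_fmeasurable) (auto intro: sets_completionI_sets)
  qed (use E in auto)
  then show ?thesis unfolding eq using MN by (simp add: divide_right_mono)
qed

lemma empirical_limit:
  assumes f: "f \<in> lip" and E: "E \<in> sets lebesgue" "\<And>t. t \<in> E \<Longrightarrow> f t = 1"
    and d: "upper_Banach_density E = ereal d"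
  shows "\<exists>\<nu>\<in>hull_measures f. d \<le> measure \<nu> peak"
proof -
  \<comment> \<open>One index controls both the length and the loss of density, so a subsequence
    inherits both through \<open>n \<le> r n\<close>.\<close>
  have "\<forall>n. \<exists>M N. real (Suc n) \<le> N - M \<and> d - 1 / real (Suc n) < measure lebesgue (E \<inter> {M..N}) / (N - M)"
    by (intro allI upper_Banach_density_gt) (simp add: d)
  then obtain M N where MN: "\<And>n. real (Suc n) \<le> N n - M n"
    and den: "\<And>n. d - 1 / real (Suc n) < measure lebesgue (E \<inter> {M n..N n}) / (N n - M n)" by metis
  have lt: "M n < N n" for n using MN[of n] by simp
  define \<mu> where "\<mu> n = empirical f (M n) (N n)" for n
  have \<mu>: "prob_space (\<mu> n)" "sets (\<mu> n) = sets lipM" for n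
    unfolding \<mu>_def by (rule empirical_prob[OF f lt])+
  obtain r \<nu> where r: "strict_mono (r :: nat \<Rightarrow> nat)" and \<nu>: "prob_space \<nu>" "sets \<nu> = sets lipM"
    and lim: "\<And>g. pcont g \<Longrightarrow> (\<lambda>n. \<integral>x. g x \<partial>\<mu> (r n)) \<longlonglongrightarrow> (\<integral>x. g x \<partial>\<nu>)"
    using weak_compactness[of \<mu>, OF \<mu>] by auto
  have rn: "n \<le> r n" for n using r by (rule seq_suble)
  have "\<nu> \<in> hull_measures f"
  proof (rule limit_in_hull_measures[OF \<nu> lim])
    fix g u assume g: "pcont g"
    obtain B where B: "\<And>x. x \<in> lip \<Longrightarrow> \<bar>g x\<bar> \<le> B" "B \<ge> 0" using pcont_bounded[OF g] by blast
    show "(\<lambda>n. (\<integral>x. g (shift_fun u x) \<partial>\<mu> (r n)) - (\<integral>x. g x \<partial>\<mu> (r n))) \<longlonglongrightarrow> 0"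
    proof (rule Lim_null_comparison, rule always_eventually, rule allI)
      fix n
      have "\<bar>(\<integral>x. g (shift_fun u x) \<partial>\<mu> (r n)) - (\<integral>x. g x \<partial>\<mu> (r n))\<bar> \<le> 4 * B * \<bar>u\<bar> / (N (r n) - M (r n))"
        unfolding \<mu>_def by (rule empirical_shift_bound[OF f lt pcont_measurable[OF g] B(1)])
      also have "\<dots> \<le> 4 * B * \<bar>u\<bar> / real (Suc n)"
        using B MN[of "r n"] rn[of n] by (intro divide_left_mono mult_pos_pos) auto
      finally show "norm ((\<integral>x. g (shift_fun u x) \<partial>\<mu> (r n)) - (\<integral>x. g x \<partial>\<mu> (r n))) \<le> 4 * B * \<bar>u\<bar> / real (Suc n)" by simp
    next
      show "(\<lambda>n. 4 * B * \<bar>u\<bar> / real (Suc n)) \<longlonglongrightarrow> 0"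
        using tendsto_mult_right_zero[OF LIMSEQ_Suc[OF lim_1_over_n], of "4 * B * \<bar>u\<bar>"] by simp
    qed
  next
    fix g n assume g: "pcont g" "\<And>s. g (shift_fun s f) = 0"
    show "(\<integral>x. g x \<partial>\<mu> (r n)) = 0"
      unfolding \<mu>_def by (subst empirical_integral[OF f lt pcont_measurable[OF g(1)]]) (simp add: g(2))
  qed
  moreover have "d \<le> measure \<nu> peak"
  proof (rule peak_upper_semicontinuous[OF \<nu> \<mu> lim])
    have "(\<lambda>n. d - 1 / real (Suc n)) \<longlonglongrightarrow> d - 0" by (intro tendsto_intros LIMSEQ_Suc[OF lim_1_over_n])
    then show "(\<lambda>n. d - 1 / real (Suc (r n))) \<longlonglongrightarrow> d" using LIMSEQ_subseq_LIMSEQ[OF _ r] by (fastforce simp: o_def)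
    show "d - 1 / real (Suc (r n)) \<le> measure (\<mu> (r n)) peak" for n
      using den[of "r n"] peak_empirical[OF f lt[of "r n"] E] unfolding \<mu>_def by linarith
  qed
  ultimately show ?thesis by blast
qed

section \<open>Averages over orbit segments and the density bound\<close>

definition average :: "real \<Rightarrow> ((real \<Rightarrow> real) \<Rightarrow> real) \<Rightarrow> (real \<Rightarrow> real) \<Rightarrow> real" where
  "average L h x = (\<integral>t. h (shift_fun t x) \<partial>uniform_measure lborel {0..L})"

lemma average_measurable_pair:
  assumes "h \<in> borel_measurable lipM"
  shows "(\<lambda>(x, t). h (shift_fun t x)) \<in> borel_measurable (lipM \<Otimes>\<^sub>M borel)"
  using measurable_compose[OF measurable_pair_swap[OF shift_fun_joint_measurable] assms]
  by (simp add: split_beta')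

text \<open>Continuity, by dominated convergence, admits the average as a test function in the orbit
  closure clause of \<open>hull_measures\<close>.\<close>

lemma average_pcont:
  assumes h: "pcont h" and L: "L > 0"
  shows "pcont (average L h)"
proof -
  let ?m = "uniform_measure lborel {0..L}"
  interpret U: prob_space "?m" using L by (intro prob_space_uniform_measure) auto
  obtain B where B: "\<And>x. x \<in> lip \<Longrightarrow> \<bar>h x\<bar> \<le> B" "B \<ge> 0" using pcont_bounded[OF h] by blast
  note [measurable] = pcont_measurable[OF h] average_measurable_pair[OF pcont_measurable[OF h]]
  have sec: "(\<lambda>t. h (shift_fun t x)) \<in> borel_measurable ?m" if "x \<in> lip" for x
    by (rule measurable_compose[OF orbit_measurable_uniform[OF that] pcont_measurable[OF h]])
  show ?thesis
  proof (rule pcontI[where B=B])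
    have "(\<lambda>(x, t). h (shift_fun t x)) \<in> borel_measurable (lipM \<Otimes>\<^sub>M ?m)" by measurable
    then show "average L h \<in> borel_measurable lipM"
      unfolding average_def by (rule U.borel_measurable_lebesgue_integral)
    show "\<bar>average L h x\<bar> \<le> B" if x: "x \<in> lip" for x
    proof -
      have "\<bar>average L h x\<bar> \<le> (\<integral>t. B \<partial>?m)" unfolding average_def
        by (intro integral_abs_bound_integral U.integrable_const_bound[where B=B] sec[OF x])
           (auto intro!: B shift_fun_lip x)
      then show ?thesis using U.prob_space by simp
    qed
    fix x y assume x: "\<And>n. x n \<in> lip" and y: "y \<in> lip" and lim: "\<And>t. (\<lambda>n. (x n :: real \<Rightarrow> real) t) \<longlonglongrightarrow> y t"
    show "(\<lambda>n. average L h (x n)) \<longlonglongrightarrow> average L h y"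
      unfolding average_def
    proof (rule integral_dominated_convergence[where w="\<lambda>_. B"])
      show "AE t in ?m. (\<lambda>n. h (shift_fun t (x n))) \<longlonglongrightarrow> h (shift_fun t y)"
        by (intro AE_I2 pcont_tendsto[OF h] shift_fun_lip x y) (simp add: shift_fun_def lim)
      show "AE t in ?m. norm (h (shift_fun t (x n))) \<le> B" for n
        by (intro AE_I2) (simp add: B shift_fun_lip x)
    qed (auto intro: sec x y)
  qed
qed

text \<open>Fubini exchanges time and space, and by invariance the inner integral is the same at
  every time.\<close>

lemma integral_average:
  assumes \<nu>: "\<nu> \<in> hull_measures f" and h: "pcont h" and L: "L > 0"
  shows "(\<integral>x. average L h x \<partial>\<nu>) = (\<integral>x. h x \<partial>\<nu>)"
proof -
  let ?m = "uniform_measure lborel {0..L}"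
  note D = hull_measuresD[OF \<nu>]
  note [measurable_cong] = D(2)
  interpret U: prob_space "?m" using L by (intro prob_space_uniform_measure) auto
  interpret V: prob_space \<nu> by (rule D)
  interpret P: pair_prob_space "?m" \<nu> ..
  obtain B where B: "\<And>x. x \<in> lip \<Longrightarrow> \<bar>h x\<bar> \<le> B" using pcont_bounded[OF h] by blast
  have m: "(\<lambda>(t, x). h (shift_fun t x)) \<in> borel_measurable (?m \<Otimes>\<^sub>M \<nu>)"
    using measurable_compose[OF shift_fun_joint_measurable pcont_measurable[OF h]]
    by (simp add: split_beta' cong: measurable_cong_sets) measurable
  have inv: "(\<integral>x. h (shift_fun t x) \<partial>\<nu>) = (\<integral>x. h x \<partial>\<nu>)" for t
  proof -
    have "(\<integral>x. h x \<partial>\<nu>) = (\<integral>x. h x \<partial>distr \<nu> lipM (shift_fun t))" by (simp add: D(3))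
    also have "\<dots> = (\<integral>x. h (shift_fun t x) \<partial>\<nu>)"
      using pcont_measurable[OF h] by (intro integral_distr) auto
    finally show ?thesis by simp
  qed
  have "(\<integral>x. average L h x \<partial>\<nu>) = (\<integral>t. (\<integral>x. h (shift_fun t x) \<partial>\<nu>) \<partial>?m)"
    unfolding average_def
    by (intro P.Fubini_integral P.P.integrable_const_bound[where B=B] m)
       (auto simp: space_pair_measure D B shift_fun_lip intro!: AE_I2)
  then show ?thesis using U.prob_space by (simp add: inv)
qed

text \<open>The positive part of \<open>average L h - c\<close> vanishes on the orbit of \<open>f\<close>, hence almost everywhere.\<close>

lemma integral_le_average:
  assumes \<nu>: "\<nu> \<in> hull_measures f" and h: "pcont h" and L: "L > 0"
    and c: "\<And>s. average L h (shift_fun s f) \<le> c"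
  shows "(\<integral>x. h x \<partial>\<nu>) \<le> c"
proof -
  note D = hull_measuresD[OF \<nu>]
  interpret V: prob_space \<nu> by (rule D)
  define g where "g x = max 0 (average L h x - c)" for x
  have av: "pcont (average L h)" by (rule average_pcont[OF h L])
  have g: "pcont g" unfolding g_def
    by (rule pcont_compose[OF av, where \<phi>="\<lambda>t. max 0 (t - c)"]) (intro continuous_intros)
  have "(\<integral>x. g x \<partial>\<nu>) = 0"
    by (rule D(5)[OF g]) (simp_all add: g_def max_absorb1 c)
  moreover have "AE x in \<nu>. 0 \<le> g x" by (simp add: g_def)
  ultimately have "AE x in \<nu>. g x = 0"
    using integral_nonneg_eq_0_iff_AE[OF pcont_integrable[OF D(1,2) g]] by blast
  then have "AE x in \<nu>. average L h x \<le> c"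
    by eventually_elim (simp add: g_def max_def split: if_splits)
  then have "(\<integral>x. average L h x \<partial>\<nu>) \<le> (\<integral>x. c \<partial>\<nu>)"
    by (intro integral_mono_AE pcont_integrable[OF D(1,2) av]) auto
  then show ?thesis by (simp add: integral_average[OF \<nu> h L] V.prob_space)
qed

text \<open>By \<open>integral_le_average\<close>, for every length \<open>L\<close> some segment of
  the orbit of \<open>f\<close> has an average above the integral minus \<open>e\<close>. Its
  starting time \<open>s\<close> gives the interval from \<open>s\<close> to \<open>s + L\<close>,
  chosen independently of the intervals from which \<nu> arose.\<close>

lemma density_ge_integral:
  assumes f: "f \<in> lip" and \<nu>: "\<nu> \<in> hull_measures f" and h: "pcont h"
    and W: "W \<in> sets borel" and hW: "\<And>t. h (shift_fun t f) \<le> indicator W t"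
  shows "ereal (\<integral>x. h x \<partial>\<nu>) \<le> upper_Banach_density W"
proof (rule upper_Banach_density_ge)
  fix L e :: real assume L: "L > 0" and e: "e > 0"
  let ?m = "uniform_measure lborel {0..L}"
  interpret U: prob_space "?m" using L by (intro prob_space_uniform_measure) auto
  have "\<not> (\<forall>s. average L h (shift_fun s f) \<le> (\<integral>x. h x \<partial>\<nu>) - e)"
    using integral_le_average[OF \<nu> h L, of "(\<integral>x. h x \<partial>\<nu>) - e"] e by auto
  then obtain s where s: "(\<integral>x. h x \<partial>\<nu>) - e < average L h (shift_fun s f)" by (auto simp: not_le)
  obtain B where B: "\<And>x. x \<in> lip \<Longrightarrow> \<bar>h x\<bar> \<le> B" using pcont_bounded[OF h] by blast
  note [measurable] = W
  have ms: "(\<lambda>t. h (shift_fun t (shift_fun s f))) \<in> borel_measurable ?m"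
    by (rule measurable_compose[OF orbit_measurable_uniform[OF shift_fun_lip[OF f]] pcont_measurable[OF h]])
  have "average L h (shift_fun s f) \<le> (\<integral>t. indicator W (s + t) \<partial>?m)"
    unfolding average_def
  proof (rule integral_mono)
    show "integrable ?m (\<lambda>t. h (shift_fun t (shift_fun s f)))"
      by (rule U.integrable_const_bound[where B=B, OF _ ms]) (auto simp: B shift_fun_lip f)
    show "integrable ?m (\<lambda>t. indicator W (s + t) :: real)"
    proof (rule U.integrable_const_bound[where B=1])
      have "(\<lambda>t. s + t) \<in> borel_measurable (borel :: real measure)" by simp
      from measurable_compose[OF this borel_measurable_indicator[OF W]]
      show "(\<lambda>t. indicator W (s + t) :: real) \<in> borel_measurable ?m"
        by (simp add: measurable_cong_sets[OF sets_uniform_measure refl])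
    qed auto
    show "h (shift_fun t (shift_fun s f)) \<le> indicator W (s + t)" for t
      using hW[of "s + t"] by (simp add: shift_fun_shift_fun add.commute)
  qed
  also have "\<dots> = (\<integral>t. indicator {0..L} t * indicator W (s + t) \<partial>lborel) / L"
    using L by (subst integral_uniform_measure) auto
  also have "(\<integral>t. indicator {0..L} t * indicator W (s + t) \<partial>lborel) = (\<integral>t. indicator (W \<inter> {s..s + L}) (s + 1 * t) \<partial>lborel :: real)"
    by (intro Bochner_Integration.integral_cong) (auto simp: indicator_def)
  also have "\<dots> = (\<integral>t. indicator (W \<inter> {s..s + L}) t \<partial>lborel)"
    using lborel_integral_real_affine[of 1 "indicator (W \<inter> {s..s + L}) :: real \<Rightarrow> real" s] by simp
  also have "\<dots> = measure lebesgue (W \<inter> {s..s + L})"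
    by (simp add: measure_completion)
  finally show "\<exists>M. (\<integral>x. h x \<partial>\<nu>) - e \<le> measure lebesgue (W \<inter> {M..M + L}) / L"
    using s by (intro exI[of _ s]) simp
qed

section \<open>The correspondence for the given set\<close>

lemma open_fatten: "open (fatten \<delta> E)"
proof -
  have "fatten \<delta> E = (\<Union>e\<in>E. ball e \<delta>)"
    by (auto simp: fatten_def dist_real_def abs_minus_commute)
  then show ?thesis by (metis open_UN open_ball)
qed

lemma mem_translate_minus: "w \<in> translate_minus A u \<longleftrightarrow> w + u \<in> A"
  by (auto simp: translate_minus_def image_iff) (metis add_diff_cancel_right')

theorem theorem1p5:
  fixes E :: "real set"
  assumes "E \<in> sets lebesgue"
    and "upper_Banach_density E > 0"
  shows "\<exists>(X :: (real \<Rightarrow> real) measure) T E'.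
           ergodic_flow X T \<and> E' \<in> sets X \<and>
           ereal (measure X E') \<ge> upper_Banach_density E \<and>
           (\<forall>U \<delta>. finite U \<and> \<delta> > 0 \<longrightarrow>
              upper_Banach_density (fatten \<delta> E \<inter> (\<Inter>u\<in>U. translate_minus (fatten \<delta> E) u))
                \<ge> ereal (measure X (E' \<inter> (\<Inter>u\<in>U. T u -` E' \<inter> space X))))"
proof -
  obtain d where d: "upper_Banach_density E = ereal d" "d > 0"
    using upper_Banach_density_finite[OF assms(2)] by blast
  \<comment> \<open>\<open>infdist\<close> to the empty set is 0 by convention, which would make
    \<open>f\<close> constantly 1 although the fattened set is empty.\<close>
  have ne: "E \<noteq> {}"
  proof
    assume "E = {}"
    then have "upper_Banach_density E \<le> 0"
      unfolding upper_Banach_density_def by (intro Limsup_bounded) (auto simp: zero_ereal_def)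
    then show False using assms(2) by simp
  qed
  define f where "f t = max 0 (1 - infdist t E)" for t
  have f: "f \<in> lip"
  proof -
    have "\<bar>f s - f t\<bar> \<le> \<bar>s - t\<bar>" for s t
      using infdist_triangle_abs[of s E t] by (auto simp: f_def dist_real_def max_def)
    then show ?thesis by (auto simp: lip_def f_def infdist_nonneg)
  qed
  obtain \<nu>0 where \<nu>0: "\<nu>0 \<in> hull_measures f" "d \<le> measure \<nu>0 peak"
    using empirical_limit[OF f assms(1) _ d(1)] by (auto simp: f_def)
  obtain \<nu> where \<nu>: "\<nu> \<in> hull_measures f" "measure \<nu>0 peak \<le> measure \<nu> peak"
    and max: "\<And>\<kappa>. \<kappa> \<in> hull_measures f \<Longrightarrow> measure \<kappa> peak \<le> measure \<nu> peak"
      "\<And>\<kappa>. \<kappa> \<in> hull_measures f \<Longrightarrow> measure \<nu> peak \<le> measure \<kappa> peak \<Longrightarrow> energy \<kappa> \<le> energy \<nu>"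
    using maximal_measure[OF \<nu>0(1)] by blast
  note D = hull_measuresD[OF \<nu>(1)]
  interpret prob_space \<nu> by (rule D)
  have [measurable]: "peak \<in> sets \<nu>" by (simp add: D)
  have "ereal (measure (completion \<nu>) (peak \<inter> (\<Inter>u\<in>U. shift_fun u -` peak \<inter> space (completion \<nu>))))
      \<le> upper_Banach_density (fatten \<delta> E \<inter> (\<Inter>u\<in>U. translate_minus (fatten \<delta> E) u))"
    if U: "finite U" and \<delta>: "\<delta> > 0" for U \<delta>
  proof -
    define Q where "Q = peak \<inter> (\<Inter>u\<in>U. shift_fun u -` peak \<inter> space (completion \<nu>))"
    define W where "W = fatten \<delta> E \<inter> (\<Inter>u\<in>U. translate_minus (fatten \<delta> E) u)"
    \<comment> \<open>\<open>f\<close> is flat at 0 from distance 1 on, so distance at least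
      \<delta> yields only \<open>f t \<le> 1 - min \<delta> 1\<close>.\<close>
    define r where "r = min \<delta> 1"
    have r: "0 < r" "r \<le> 1" "r \<le> \<delta>" using \<delta> by (auto simp: r_def)
    \<comment> \<open>Each factor is 1 at the value 1 and 0 at values up to \<open>1 - r\<close>.
      The index 0 accounts for the untranslated copy of the set.\<close>
    define h where "h x = (\<Prod>u\<in>insert 0 U. max 0 (1 - (1 - x u) / r))" for x :: "real \<Rightarrow> real"
    have fU: "finite (insert 0 U)" using U by simp
    have h: "pcont h" unfolding h_def
      by (intro pcont_prod fU pcont_compose[OF pcont_eval, where \<phi>="\<lambda>t. max 0 (1 - (1 - t) / r)"] continuous_intros)
         (use r in auto)
    have h0: "0 \<le> h x" for x unfolding h_def by (intro prod_nonneg) auto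
    have h1: "h x \<le> 1" if "x \<in> lip" for x unfolding h_def
      using lipD(2)[OF that] r by (intro prod_le_1) auto
    have Q: "Q \<in> sets \<nu>"
    proof -
      have "shift_fun u -` peak \<inter> lip \<in> sets \<nu>" for u
        using measurable_sets[OF shift_fun_measurable peak_sets, of u] by (simp add: D)
      then have "U \<noteq> {} \<Longrightarrow> (\<Inter>u\<in>U. shift_fun u -` peak \<inter> lip) \<in> sets \<nu>"
        using U by (intro sets.finite_INT) auto
      \<comment> \<open>The empty intersection is \<open>UNIV\<close>, which lies outside the
        sigma-algebra unless it is cut down by \<open>peak\<close>; hence the separate case.\<close>
      then show ?thesis by (cases "U = {}") (simp_all add: Q_def D(2,4) sets.Int)
    qed
    have Wb: "W \<in> sets borel"
    proof -
      have "open (translate_minus (fatten \<delta> E) u)" for u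
      proof -
        have "translate_minus (fatten \<delta> E) u = (\<lambda>w. w + u) -` fatten \<delta> E" by (auto simp: mem_translate_minus)
        then show ?thesis by (auto intro!: open_vimage open_fatten continuous_intros)
      qed
      then have "open W" unfolding W_def using U by (intro open_Int open_fatten open_INT) auto
      then show ?thesis by simp
    qed
    \<comment> \<open>The fattening is used here: a time outside \<open>W\<close> has some
      \<open>t + u\<close> at distance at least \<delta> from \<open>E\<close>, and the
      corresponding factor of \<open>h\<close> vanishes.\<close>
    have hW: "h (shift_fun t f) \<le> indicator W t" for t
    proof (cases "t \<in> W")
      case True
      then show ?thesis using h1[OF shift_fun_lip[OF f]] by simp
    next
      case False
      then have "\<exists>u\<in>insert 0 U. t + u \<notin> fatten \<delta> E"
        by (auto simp: W_def mem_translate_minus)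
      then obtain u where u: "u \<in> insert 0 U" "t + u \<notin> fatten \<delta> E" by blast
      have "\<delta> \<le> infdist (t + u) E"
        unfolding infdist_def using ne u(2) by (auto intro!: cINF_greatest simp: fatten_def dist_real_def not_less)
      then have "max 0 (1 - (1 - shift_fun t f u) / r) = 0"
        using r by (auto simp: f_def shift_fun_def max_def field_simps)
      then have "h (shift_fun t f) = 0" unfolding h_def using u fU by (intro prod_zero) auto
      then show ?thesis by simp
    qed
    have "measure (completion \<nu>) Q = (\<integral>x. indicator Q x \<partial>\<nu>)" using Q by simp
    also have "\<dots> \<le> (\<integral>x. h x \<partial>\<nu>)"
    proof (rule integral_mono)
      show "integrable \<nu> (indicator Q :: _ \<Rightarrow> real)" using Q by (simp add: emeasure_eq_measure)
      show "indicator Q x \<le> h x" for x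
      proof (cases "x \<in> Q")
        case True
        have "x u = 1" if "u \<in> insert 0 U" for u
        proof -
          have "shift_fun u x \<in> peak" using True that unfolding Q_def by (cases "u = 0") (simp, blast)
          then show ?thesis by (simp add: peak_def shift_fun_def)
        qed
        then have "h x = 1" unfolding h_def by (intro prod.neutral) auto
        then show ?thesis by simp
      qed (simp add: h0)
    qed (rule pcont_integrable[OF D(1,2) h])
    finally have "ereal (measure (completion \<nu>) Q) \<le> ereal (\<integral>x. h x \<partial>\<nu>)" by simp
    also have "\<dots> \<le> upper_Banach_density W" by (rule density_ge_integral[OF f \<nu>(1) h Wb hW])
    finally show ?thesis unfolding Q_def W_def .
  qed
  moreover have "ergodic_flow (completion \<nu>) shift_fun"
    by (rule maximal_ergodic[OF \<nu>(1) max])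
  moreover have "upper_Banach_density E \<le> ereal (measure (completion \<nu>) peak)"
    using \<nu>0 \<nu> d by simp
  ultimately show ?thesis
    by (intro exI[of _ "completion \<nu>"] exI[of _ shift_fun] exI[of _ peak]) auto
qed

end
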